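(* Let $d\ge 3$, let $a_1,\dots,a_d$ be integers, not all zero, and let $b_1,\dots,b_d$ be integers, not all zero, such that the vectors $(a_1,\dots,a_d)$ and $(b_1,\dots,b_d)$ are not parallel. Let $$S_{d-2}=\{\mathbf{x}=(x_1,\dots,x_d)\in\mathbb{Z}^d:\ a_1x_1+\cdots+a_dx_d=0,\ b_1x_1+\cdots+b_dx_d=0\}.$$ Then, for the simple symmetric random walk on $\mathbb{Z}^d$ started at the origin, $$\lim_{n\to\infty}\frac{\xi^{(d)}_{S_{d-2}}(n)}{\log\log n}=\lambda_d\qquad\text{almost surely}.$$
   Context: The simple symmetric random walk on $\mathbb{Z}^d$ is $\mathbf{S}_0=\mathbf{0}$, $\mathbf{S}_n=\sum_{k=1}^n\mathbf{X}_k$, where $\mathbf{X}_1,\mathbf{X}_2,\dots$ are i.i.d. with $\mathbf{P}(\mathbf{X}_1=\mathbf{e}_i)=\mathbf{P}(\mathbf{X}_1=-\mathbf{e}_i)=\frac1{2d}$ for $i=1,\dots,d$, and $\mathbf{e}_1,\dots,\mathbf{e}_d$ are the standard unit vectors of $\mathbb{Z}^d$. Its local time at $\mathbf{x}\in\mathbb{Z}^d$ is $\xi^{(d)}(\mathbf{x},n)=\#\{k:\ 0<k\le n,\ \mathbf{S}_k=\mathbf{x}\}$. For $A\subseteq\mathbb{Z}^d$, $\xi^{(d)}_A(n)=\max_{\mathbf{x}\in A}\xi^{(d)}(\mathbf{x},n)$. For $d\ge3$, $\gamma_d=\mathbf{P}(\mathbf{S}_k\ne\mathbf{0}\text{ for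 all }k\ge1)$ is the probability that the walk never returns to its starting point ($0<\gamma_d<1$), and $\lambda_d=-\dfrac{1}{\log(1-\gamma_d)}$. *)

theory Defs
  imports "HOL-Probability.Probability"
begin

text \<open>The lattice of dimension \<open>d\<close> is the type \<^typ>\<open>int ^ 'd\<close>, with \<open>d = CARD('d)\<close>, and
  the unit vectors are \<open>axis i 1\<close>. The walk may live on any probability space: \<open>X k\<close> is its
  \<open>k\<close>-th step for \<open>k \<ge> 1\<close>, and \<open>X 0\<close> is never used.\<close>

locale simple_symmetric_random_walk = prob_space M
  for M :: "'a measure" +
  fixes X :: "nat \<Rightarrow> 'a \<Rightarrow> int ^ 'd"
  assumes indep_steps: "indep_vars (\<lambda>_. count_space UNIV) X {1..}"
    and step_pos: "\<And>k i. 1 \<le> k \<Longrightarrow>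
      prob {\<omega> \<in> space M. X k \<omega> = axis i 1} = 1 / (2 * real CARD('d))"
    and step_neg: "\<And>k i. 1 \<le> k \<Longrightarrow>
      prob {\<omega> \<in> space M. X k \<omega> = - axis i 1} = 1 / (2 * real CARD('d))"

definition walk :: "(nat \<Rightarrow> 'a \<Rightarrow> int ^ 'd) \<Rightarrow> nat \<Rightarrow> 'a \<Rightarrow> int ^ 'd"
  where "walk X n \<omega> = (\<Sum>k = 1..n. X k \<omega>)"

definition local_time :: "(nat \<Rightarrow> 'a \<Rightarrow> int ^ 'd) \<Rightarrow> int ^ 'd \<Rightarrow> nat \<Rightarrow> 'a \<Rightarrow> nat"
  where "local_time X x n \<omega> = card {k. 0 < k \<and> k \<le> n \<and> walk X k \<omega> = x}"

text \<open>Local times up to \<open>n\<close> lie in \<open>{0..n}\<close>, so the maximum below is over a finite set even when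
  \<open>A\<close> is infinite; \<open>A\<close> should be nonempty.\<close>

definition max_local_time ::
    "(nat \<Rightarrow> 'a \<Rightarrow> int ^ 'd) \<Rightarrow> (int ^ 'd) set \<Rightarrow> nat \<Rightarrow> 'a \<Rightarrow> nat"
  where "max_local_time X A n \<omega> = Max ((\<lambda>x. local_time X x n \<omega>) ` A)"

text \<open>For a simple symmetric random walk, the next two quantities depend on the dimension only,
  since the dimension determines the joint law of the steps.\<close>

definition escape_prob :: "'a measure \<Rightarrow> (nat \<Rightarrow> 'a \<Rightarrow> int ^ 'd) \<Rightarrow> real"
  where "escape_prob M X = measure M {\<omega> \<in> space M. \<forall>k\<ge>1. walk X k \<omega> \<noteq> 0}"

definition walk_lambda :: "'a measure \<Rightarrow> (nat \<Rightarrow> 'a \<Rightarrow> int ^ 'd) \<Rightarrow> real"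
  where "walk_lambda M X = - (1 / ln (1 - escape_prob M X))"

text \<open>Only meant for nonzero vectors, where it is symmetric.\<close>

definition parallel_vec :: "int ^ 'd \<Rightarrow> int ^ 'd \<Rightarrow> bool"
  where "parallel_vec a b \<longleftrightarrow> (\<exists>c::real. \<forall>i. real_of_int (b $ i) = c * real_of_int (a $ i))"

definition lattice_subspace :: "int ^ 'd \<Rightarrow> int ^ 'd \<Rightarrow> (int ^ 'd) set"
  where "lattice_subspace a b =
    {x. (\<Sum>i\<in>UNIV. a $ i * x $ i) = 0 \<and> (\<Sum>i\<in>UNIV. b $ i * x $ i) = 0}"

end

theory Submission
  imports Defs "HOL-Real_Asymp.Real_Asymp"
begin

text \<open>Put \<open>\<beta> = 1 - \<gamma>\<close>, so that \<open>\<lambda> = 1 / ln (1 / \<beta>)\<close>. Each time the walk arrives at a new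
point, it comes back to that point at least \<open>m\<close> more times with probability \<open>\<beta> ^ m\<close>. The
subspace has codimension two: the walk is in it exactly when a two-dimensional projection of the
walk is at the origin, and such a projection is just barely recurrent, so that by time \<open>n\<close> the
subspace has been visited about \<open>ln n\<close> times. The maximal local time is thus the maximum of about
\<open>ln n\<close> geometric variables, and the threshold is the \<open>m\<close> with \<open>ln n * \<beta> ^ m = 1\<close>, that is,
\<open>m = \<lambda> * ln (ln n)\<close>.

Upper bound. By a union bound over the times at which the walk is in the subspace, the probability
that some point of it is visited more than \<open>m\<close> times is at most \<open>\<beta> ^ m\<close> times the expected number
of visits to the subspace (\<open>path_prob_exists_visits_le\<close>).

Lower bound. Fix a large \<open>s\<close>. From a point of the subspace, let the walk try to return to it \<open>m\<close>
times within time \<open>m * s\<close>; this succeeds with probability at least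
\<open>\<rho> ^ m\<close>, where \<open>\<rho>\<close> is the probability of returning within time \<open>s\<close>, which is close to \<open>\<beta>\<close>
(\<open>path_prob_visits_ge\<close>). If the attempt fails, wait until the walk is in the subspace again. The
wait is longer than \<open>N\<close> with probability at most of order \<open>m * s / ln N\<close>, by a last-exit
argument (\<open>hitting_mass_times_avoidance_le\<close>), so all of \<open>N\<close> such attempts fail only with a
small probability (\<open>fail_prob_le\<close>), and they take at most time \<open>N\<^sup>2\<close>, which leaves \<open>ln (ln _)\<close>
essentially unchanged.

Three facts on the walk are needed. The expected number of visits to
the subspace is at most of order \<open>ln n\<close>, because \<open>ln (\<bar>P x\<bar>\<^sup>2 + C)\<close>, where \<open>P\<close> is the
orthogonal projection onto the span of the two normal vectors, is subharmonic for the walk if \<open>C\<close>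
is large, with an increment bounded below on the subspace
(\<open>lattice_subspace_green_le_log\<close>). It is at least of order \<open>ln n\<close>, because the projected walk at
time \<open>n\<close> is spread over at most order \<open>n\<close> values (\<open>lattice_subspace_green_ge_log\<close>). Finally
\<open>\<gamma> > 0\<close>, because \<open>- (\<bar>x\<bar>\<^sup>2 + C) powr (- 1 / 8)\<close> is a bounded subharmonic function in dimension at
least three (\<open>origin_green_bounded\<close>).

Both estimates are summable along the times \<open>2 ^ 2 ^ i\<close>, at which \<open>ln (ln _)\<close> grows linearly in
\<open>i\<close>; the Borel-Cantelli lemma gives the two bounds there, and monotonicity of the local times
fills the gaps. All estimates concern finitely many steps and are therefore statements about
uniform averages over the finitely many sequences of unit steps of a given length; independence of
the steps becomes the concatenation of sequences (\<open>path_mean_append\<close>).\<close>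

section \<open>Averages over step sequences\<close>

definition unit_steps :: "(int ^ 'd) set"
  where "unit_steps = range (\<lambda>i. axis i 1) \<union> range (\<lambda>i. - axis i 1)"

text \<open>The average of \<open>f\<close> over all sequences of \<open>n\<close> unit steps. The recursion on the first step makes
  linearity, monotonicity and the splitting of sequences immediate inductions.\<close>

primrec path_mean :: "nat \<Rightarrow> ((int ^ 'd) list \<Rightarrow> real) \<Rightarrow> real" where
  "path_mean 0 f = f []"
| "path_mean (Suc n) f =
    (\<Sum>v\<in>unit_steps. path_mean n (\<lambda>xs. f (v # xs))) / (2 * real CARD('d))"

abbreviation path_prob :: "nat \<Rightarrow> ((int ^ 'd) list \<Rightarrow> bool) \<Rightarrow> real"
  where "path_prob n P \<equiv> path_mean n (\<lambda>xs. of_bool (P xs))"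

lemma axis_one_neq_minus_axis_one: "axis i (1::int) \<noteq> - axis j 1"
proof
  assume "axis i (1::int) = - axis j 1"
  then have "axis i (1::int) $ i = (- axis j 1) $ i" by simp
  then show False by (simp add: axis_def split: if_splits)
qed

lemma finite_unit_steps [simp]: "finite unit_steps"
  by (simp add: unit_steps_def)

lemma uminus_unit_steps: "uminus ` unit_steps = unit_steps"
  by (auto simp: unit_steps_def image_Un image_image)

lemma sum_unit_steps:
  fixes f :: "int ^ 'd \<Rightarrow> 'b::comm_monoid_add"
  shows "(\<Sum>v\<in>unit_steps. f v) = (\<Sum>i\<in>UNIV. f (axis i 1) + f (- axis i 1))"
proof -
  have i: "inj (\<lambda>i::'d. axis i (1::int))"
    by (auto simp: inj_on_def axis_eq_axis)
  then have i': "inj (\<lambda>i::'d. - axis i (1::int))"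
    by (auto simp: inj_on_def)
  have "range (\<lambda>i::'d. axis i (1::int)) \<inter> range (\<lambda>i. - axis i 1) = {}"
    using axis_one_neq_minus_axis_one by blast
  then have "(\<Sum>v\<in>unit_steps. f v) =
      sum f (range (\<lambda>i. axis i 1)) + sum f (range (\<lambda>i. - axis i 1))"
    unfolding unit_steps_def by (intro sum.union_disjoint) auto
  then show ?thesis
    by (simp add: sum.reindex[OF i] sum.reindex[OF i'] sum.distrib)
qed

lemma card_unit_steps: "card (unit_steps :: (int ^ 'd) set) = 2 * CARD('d)"
  using sum_unit_steps[of "\<lambda>_ :: int ^ 'd. 1::nat"] by simp

lemma path_mean_mono:
  fixes f g :: "(int ^ 'd) list \<Rightarrow> real"
  assumes "\<And>xs. length xs = n \<Longrightarrow> set xs \<subseteq> unit_steps \<Longrightarrow> f xs \<le> g xs"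
  shows "path_mean n f \<le> path_mean n g"
  using assms
proof (induction n arbitrary: f g)
  case (Suc n)
  have "path_mean n (\<lambda>xs. f (v # xs)) \<le> path_mean n (\<lambda>xs. g (v # xs))" if "v \<in> unit_steps" for v
    by (rule Suc.IH) (use Suc.prems that in auto)
  then show ?case by (auto intro!: divide_right_mono sum_mono)
qed auto

lemma path_mean_cong:
  fixes f g :: "(int ^ 'd) list \<Rightarrow> real"
  assumes "\<And>xs. length xs = n \<Longrightarrow> set xs \<subseteq> unit_steps \<Longrightarrow> f xs = g xs"
  shows "path_mean n f = path_mean n g"
  by (intro antisym path_mean_mono) (use assms in auto)

lemma path_mean_const [simp]: "path_mean n (\<lambda>_ :: (int ^ 'd) list. c) = c"
  by (induction n) (auto simp: card_unit_steps)

lemma path_mean_add: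
  "path_mean n (\<lambda>xs. f xs + g xs) = path_mean n f + path_mean n g"
  by (induction n arbitrary: f g) (auto simp: sum.distrib add_divide_distrib)

lemma path_mean_cmult: "path_mean n (\<lambda>xs. c * f xs) = c * path_mean n f"
  by (induction n arbitrary: f) (auto simp: sum_distrib_left)

lemma path_mean_multc: "path_mean n (\<lambda>xs. f xs * c) = path_mean n f * c"
  using path_mean_cmult[of n c f] by (simp add: mult.commute)

lemma path_mean_diff:
  "path_mean n (\<lambda>xs. f xs - g xs) = path_mean n f - path_mean n g"
  using path_mean_add[of n f "\<lambda>xs. - 1 * g xs"] path_mean_cmult[of n "-1" g] by simp

lemma path_mean_sum:
  "path_mean n (\<lambda>xs. \<Sum>i\<in>I. f i xs) = (\<Sum>i\<in>I. path_mean n (f i))"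
  by (induction I rule: infinite_finite_induct) (auto simp: path_mean_add)

lemma path_prob_nonneg: "0 \<le> path_prob n P"
  using path_mean_mono[of n "\<lambda>_. 0" "\<lambda>xs. of_bool (P xs)"] by simp

lemma path_prob_le_one: "path_prob n P \<le> 1"
  using path_mean_mono[of n "\<lambda>xs. of_bool (P xs)" "\<lambda>_. 1"] by simp

lemma path_prob_mono:
  assumes "\<And>xs. length xs = n \<Longrightarrow> P xs \<Longrightarrow> Q xs"
  shows "path_prob n P \<le> path_prob n Q"
  by (rule path_mean_mono) (use assms in \<open>auto simp: of_bool_def\<close>)

lemma path_prob_not: "path_prob n (\<lambda>xs. \<not> P xs) = 1 - path_prob n P"
proof -
  have "path_prob n (\<lambda>xs. \<not> P xs) = path_mean n (\<lambda>xs. 1 - of_bool (P xs))"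
    by (rule path_mean_cong) auto
  then show ?thesis by (simp add: path_mean_diff)
qed

lemma path_mean_append:
  "path_mean (m + n) f = path_mean m (\<lambda>xs. path_mean n (\<lambda>ys. f (xs @ ys)))"
  by (induction m arbitrary: f) auto

text \<open>The Markov property: the steps up to a fixed time and those after it are independent, and the
  latter form again a walk.\<close>

lemma path_mean_take_drop:
  assumes "j \<le> n"
  shows "path_mean n (\<lambda>xs. f (take j xs) * g (drop j xs)) = path_mean j f * path_mean (n - j) g"
proof -
  have "path_mean n (\<lambda>xs. f (take j xs) * g (drop j xs)) =
      path_mean j (\<lambda>xs. path_mean (n - j) (\<lambda>ys. f (take j (xs @ ys)) * g (drop j (xs @ ys))))"
    using path_mean_append[of j "n - j" "\<lambda>xs. f (take j xs) * g (drop j xs)"] assms by simp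
  also have "\<dots> = path_mean j (\<lambda>xs. f xs * path_mean (n - j) g)"
    by (rule path_mean_cong) (simp add: path_mean_cmult)
  finally show ?thesis by (simp add: path_mean_multc)
qed

lemma path_mean_take:
  assumes "j \<le> n"
  shows "path_mean n (\<lambda>xs. f (take j xs)) = path_mean j f"
  using path_mean_take_drop[OF assms, of f "\<lambda>_. 1"] by simp

lemma path_mean_uminus:
  fixes f :: "(int ^ 'd) list \<Rightarrow> real"
  shows "path_mean n (\<lambda>xs. f (map uminus xs)) = path_mean n f"
proof (induction n arbitrary: f)
  case (Suc n)
  have "path_mean (Suc n) (\<lambda>xs. f (map uminus xs)) =
      (\<Sum>v\<in>unit_steps. path_mean n (\<lambda>xs. f (- v # xs))) / (2 * real CARD('d))"
    using Suc[of "\<lambda>xs. f (- v # xs)" for v] by simp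
  also have "(\<Sum>v\<in>unit_steps. path_mean n (\<lambda>xs. f (- v # xs))) =
      (\<Sum>v\<in>uminus ` unit_steps. path_mean n (\<lambda>xs. f (v # xs)))"
    by (subst sum.reindex) (auto simp: inj_on_def)
  finally show ?case by (simp add: uminus_unit_steps)
qed auto

lemma path_mean_eq_sum:
  fixes f :: "(int ^ 'd) list \<Rightarrow> real"
  shows "path_mean n f =
    (\<Sum>xs | set xs \<subseteq> unit_steps \<and> length xs = n. f xs) / (2 * real CARD('d)) ^ n"
proof (induction n arbitrary: f)
  case 0
  have "{xs::(int ^ 'd) list. set xs \<subseteq> unit_steps \<and> length xs = 0} = {[]}" by auto
  then show ?case by simp
next
  case (Suc n)
  let ?P = "\<lambda>n. {xs::(int ^ 'd) list. set xs \<subseteq> unit_steps \<and> length xs = n}"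
  have eq: "?P (Suc n) = (\<lambda>(v, xs). v # xs) ` (unit_steps \<times> ?P n)"
    by (auto simp: length_Suc_conv image_iff)
  have "sum f (?P (Suc n)) = (\<Sum>v\<in>unit_steps. \<Sum>xs\<in>?P n. f (v # xs))"
    unfolding eq sum.cartesian_product by (subst sum.reindex) (auto simp: inj_on_def split_def)
  then show ?case
    by (simp add: Suc sum_divide_distrib[symmetric] divide_divide_eq_left mult.commute)
qed

section \<open>Visits and first hits\<close>

text \<open>The time 0 does not count, in agreement with \<^const>\<open>local_time\<close>.\<close>

definition visits :: "(int ^ 'd) list \<Rightarrow> int ^ 'd \<Rightarrow> nat"
  where "visits xs x = card {j \<in> {1..length xs}. sum_list (take j xs) = x}"

text \<open>The last position of the path is its first one in \<open>A\<close> after time \<open>w\<close>. Statements about a first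
  hitting time are made by evaluating this predicate at the initial segments of a path.\<close>

definition first_hit :: "nat \<Rightarrow> (int ^ 'd) set \<Rightarrow> (int ^ 'd) list \<Rightarrow> bool"
  where "first_hit w A xs \<longleftrightarrow> w < length xs \<and> sum_list xs \<in> A \<and>
    (\<forall>i\<in>{w<..<length xs}. sum_list (take i xs) \<notin> A)"

lemma visits_append: "visits (xs @ ys) x = visits xs x + visits ys (x - sum_list xs)"
proof -
  let ?m = "length xs" and ?n = "length ys"
  have eq: "{j \<in> {1..?m + ?n}. sum_list (take j (xs @ ys)) = x} =
      {j \<in> {1..?m}. sum_list (take j xs) = x} \<union>
      (\<lambda>j. ?m + j) ` {j \<in> {1..?n}. sum_list (take j ys) = x - sum_list xs}"
    (is "?L = ?A \<union> ?B")
  proof (intro equalityI subsetI)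
    fix j assume j: "j \<in> ?L"
    show "j \<in> ?A \<union> ?B"
    proof (cases "j \<le> ?m")
      case False
      then have "j = ?m + (j - ?m)" by simp
      moreover have "j - ?m \<in> {j \<in> {1..?n}. sum_list (take j ys) = x - sum_list xs}"
        using j False by (auto simp: algebra_simps)
      ultimately show ?thesis by blast
    qed (use j in auto)
  qed auto
  have "visits (xs @ ys) x = card (?A \<union> ?B)"
    unfolding visits_def length_append eq ..
  also have "\<dots> = card ?A + card ?B"
    by (intro card_Un_disjoint) auto
  also have "card ?B = card {j \<in> {1..?n}. sum_list (take j ys) = x - sum_list xs}"
    by (intro card_image) auto
  finally show ?thesis by (simp add: visits_def)
qed

lemma visits_take_drop:
  "visits xs x = visits (take j xs) x + visits (drop j xs) (x - sum_list (take j xs))"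
  using visits_append[of "take j xs" "drop j xs" x] by simp

lemma visits_take_le: "visits (take j xs) x \<le> visits xs x"
  using visits_take_drop[of xs x j] by simp

lemma visits_drop_le:
  "visits (drop j xs) x \<le> visits xs (sum_list (take j xs) + x)"
  using visits_take_drop[of xs "sum_list (take j xs) + x" j] by simp

lemma first_hit_take_iff:
  assumes "j \<le> length xs"
  shows "first_hit w A (take j xs) \<longleftrightarrow> w < j \<and> sum_list (take j xs) \<in> A \<and>
    (\<forall>i\<in>{w<..<j}. sum_list (take i xs) \<notin> A)"
  using assms by (auto simp: first_hit_def min_def)

lemma visits_first_hit:
  assumes "first_hit 0 {x} xs"
  shows "visits xs x = 1"
proof -
  have "{j \<in> {1..length xs}. sum_list (take j xs) = x} = {length xs}"
  proof (intro equalityI subsetI)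
    fix j assume j: "j \<in> {j \<in> {1..length xs}. sum_list (take j xs) = x}"
    then have "j \<notin> {0<..<length xs}"
      using assms unfolding first_hit_def by blast
    with j show "j \<in> {length xs}" by auto
  qed (use assms in \<open>auto simp: first_hit_def Suc_le_eq\<close>)
  then show ?thesis by (simp add: visits_def)
qed

lemma first_hit_exists:
  assumes "i \<in> {w<..length xs}" "sum_list (take i xs) \<in> A"
  shows "\<exists>j\<in>{w<..i}. first_hit w A (take j xs)"
proof -
  obtain j where j: "j \<in> {w<..i} \<and> sum_list (take j xs) \<in> A"
    and min: "\<And>l. l < j \<Longrightarrow> \<not> (l \<in> {w<..i} \<and> sum_list (take l xs) \<in> A)"
    using exists_least_iff[of "\<lambda>j. j \<in> {w<..i} \<and> sum_list (take j xs) \<in> A"] assms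
    by (metis greaterThanAtMost_iff order_refl)
  have "sum_list (take l xs) \<notin> A" if "l \<in> {w<..<j}" for l
    using min[of l] that j by simp
  then have "first_hit w A (take j xs)"
    using j assms by (subst first_hit_take_iff) simp_all
  with j show ?thesis by blast
qed

lemma first_hit_unique:
  assumes "first_hit w A (take i xs)" "first_hit w A (take j xs)" "i \<le> length xs" "j \<le> length xs"
  shows "i = j"
proof -
  have "\<not> i < j" if "first_hit w A (take i xs)" "first_hit w A (take j xs)"
      "i \<le> length xs" "j \<le> length xs" for i j
    using that(1,2) unfolding first_hit_take_iff[OF that(3)] first_hit_take_iff[OF that(4)]
    by auto
  from this[of i j] this[of j i] assms show ?thesis by auto
qed

lemma sum_first_hit:
  assumes "j \<in> {w<..length xs}" "first_hit w A (take j xs)"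
  shows "(\<Sum>i\<in>{w<..length xs}. of_bool (first_hit w A (take i xs)) * f i) = (f j :: real)"
proof -
  have "(\<Sum>i\<in>{w<..length xs}. of_bool (first_hit w A (take i xs)) * f i) =
      (\<Sum>i\<in>{w<..length xs}. if i = j then f j else 0)"
    using assms by (intro sum.cong) (auto dest: first_hit_unique[OF _ assms(2)])
  then show ?thesis using assms by simp
qed

lemma sum_first_hit_no_hit:
  assumes "\<not> (\<exists>i\<in>{w<..length xs}. sum_list (take i xs) \<in> A)"
  shows "(\<Sum>i\<in>{w<..length xs}. of_bool (first_hit w A (take i xs)) * f i) = (0 :: real)"
proof (intro sum.neutral ballI)
  fix i assume "i \<in> {w<..length xs}"
  then show "of_bool (first_hit w A (take i xs)) * f i = 0"
    using assms first_hit_take_iff[of i xs w A] by auto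
qed

lemma sum_of_bool_first_hit:
  "(\<Sum>i\<in>{w<..length xs}. of_bool (first_hit w A (take i xs))) =
    (of_bool (\<exists>i\<in>{w<..length xs}. sum_list (take i xs) \<in> A) :: real)"
proof (cases "\<exists>i\<in>{w<..length xs}. sum_list (take i xs) \<in> A")
  case True
  then obtain i where i: "i \<in> {w<..length xs}" "sum_list (take i xs) \<in> A" ..
  from first_hit_exists[OF i] obtain j where "j \<in> {w<..i}" "first_hit w A (take j xs)" ..
  then have "j \<in> {w<..length xs}" "first_hit w A (take j xs)" using i(1) by simp_all
  from sum_first_hit[OF this, of "\<lambda>_. 1"] True show ?thesis by simp
next
  case False
  have "(\<Sum>i\<in>{w<..length xs}. of_bool (first_hit w A (take i xs))) = (0 :: real)"
    using sum_first_hit_no_hit[OF False, of "\<lambda>_. 1"] unfolding mult_1_right .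
  also have "\<dots> = of_bool (\<exists>i\<in>{w<..length xs}. sum_list (take i xs) \<in> A)"
    unfolding of_bool_def if_not_P[OF False] ..
  finally show ?thesis .
qed

text \<open>The probability of a return to the start by time \<open>n\<close>; the singleton makes it an instance of the
  hitting probabilities below.\<close>

abbreviation return_prob :: "'d::finite itself \<Rightarrow> nat \<Rightarrow> real"
  where "return_prob _ n \<equiv>
    path_prob n (\<lambda>xs :: (int ^ 'd) list. \<exists>i\<in>{0<..n}. sum_list (take i xs) \<in> {0})"

lemma hit_prob_eq_sum:
  fixes A :: "(int ^ 'd) set"
  shows "path_prob n (\<lambda>xs. \<exists>i\<in>{w<..n}. sum_list (take i xs) \<in> A) =
    (\<Sum>j\<in>{w<..n}. path_prob j (first_hit w A))"
proof -
  have eq: "of_bool (\<exists>i\<in>{w<..n}. sum_list (take i xs) \<in> A) =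
      (\<Sum>j\<in>{w<..n}. of_bool (first_hit w A (take j xs)) :: real)"
    if n: "length xs = n" for xs :: "(int ^ 'd) list"
    unfolding n[symmetric] sum_of_bool_first_hit ..
  have "path_prob n (\<lambda>xs. \<exists>i\<in>{w<..n}. sum_list (take i xs) \<in> A) =
      path_mean n (\<lambda>xs. \<Sum>j\<in>{w<..n}. of_bool (first_hit w A (take j xs)))"
    by (rule path_mean_cong, rule eq)
  also have "\<dots> = (\<Sum>j\<in>{w<..n}. path_prob n (\<lambda>xs. first_hit w A (take j xs)))"
    unfolding path_mean_sum ..
  also have "\<dots> = (\<Sum>j\<in>{w<..n}. path_prob j (first_hit w A))"
    by (intro sum.cong refl path_mean_take[where f = "\<lambda>xs. of_bool (first_hit w A xs)"]) auto
  finally show ?thesis .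
qed

text \<open>Decomposition at the first return to the origin.\<close>

lemma of_bool_visits_ge_Suc:
  "of_bool (visits xs 0 \<ge> Suc m) = (\<Sum>j\<in>{0<..length xs}.
    of_bool (first_hit 0 {0} (take j xs)) * of_bool (visits (drop j xs) 0 \<ge> m) :: real)"
proof (cases "\<exists>i\<in>{0<..length xs}. sum_list (take i xs) \<in> {0}")
  case True
  then obtain i where i: "i \<in> {0<..length xs}" "sum_list (take i xs) \<in> {0}" ..
  from first_hit_exists[OF i] obtain j where "j \<in> {0<..i}" "first_hit 0 {0} (take j xs)" ..
  then have j: "j \<in> {0<..length xs}" "first_hit 0 {0} (take j xs)" using i(1) by simp_all
  have "visits (take j xs) 0 = 1" "sum_list (take j xs) = 0"
    using visits_first_hit[OF j(2)] j(2) by (simp_all add: first_hit_def)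
  then have "visits xs 0 = Suc (visits (drop j xs) 0)"
    using visits_take_drop[of xs 0 j] by simp
  then show ?thesis
    by (subst sum_first_hit[OF j]) simp
next
  case False
  then have e: "{j \<in> {1..length xs}. sum_list (take j xs) = 0} = {}"
    by auto
  have "visits xs 0 = 0" unfolding visits_def e by simp
  then show ?thesis by (subst sum_first_hit_no_hit[OF False]) simp
qed

lemma path_prob_visits_Suc:
  "path_prob n (\<lambda>xs :: (int ^ 'd) list. visits xs 0 \<ge> Suc m) =
    (\<Sum>j\<in>{0<..n}. path_prob j (first_hit 0 {0 :: int ^ 'd}) *
      path_prob (n - j) (\<lambda>xs :: (int ^ 'd) list. visits xs 0 \<ge> m))"
proof -
  have eq: "of_bool (visits xs 0 \<ge> Suc m) = (\<Sum>j\<in>{0<..n}.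
      of_bool (first_hit 0 {0} (take j xs)) * of_bool (visits (drop j xs) 0 \<ge> m) :: real)"
    if n: "length xs = n" for xs :: "(int ^ 'd) list"
    unfolding n[symmetric] by (rule of_bool_visits_ge_Suc)
  have "path_prob n (\<lambda>xs :: (int ^ 'd) list. visits xs 0 \<ge> Suc m) =
      path_mean n (\<lambda>xs. \<Sum>j\<in>{0<..n}. of_bool (first_hit 0 {0 :: int ^ 'd} (take j xs)) *
        of_bool (visits (drop j xs) 0 \<ge> m))"
    by (rule path_mean_cong, rule eq)
  also have "\<dots> = (\<Sum>j\<in>{0<..n}. path_mean n (\<lambda>xs.
      of_bool (first_hit 0 {0 :: int ^ 'd} (take j xs)) * of_bool (visits (drop j xs) 0 \<ge> m)))"
    unfolding path_mean_sum ..
  also have "\<dots> = (\<Sum>j\<in>{0<..n}. path_prob j (first_hit 0 {0 :: int ^ 'd}) *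
      path_prob (n - j) (\<lambda>xs :: (int ^ 'd) list. visits xs 0 \<ge> m))"
    by (intro sum.cong refl path_mean_take_drop[where f = "\<lambda>xs. of_bool (first_hit 0 {0} xs)"
      and g = "\<lambda>xs. of_bool (visits xs 0 \<ge> m)"]) auto
  finally show ?thesis .
qed

lemma path_prob_visits_mono:
  assumes "m \<le> n"
  shows "path_prob m (\<lambda>xs :: (int ^ 'd) list. visits xs 0 \<ge> k) \<le>
    path_prob n (\<lambda>xs :: (int ^ 'd) list. visits xs 0 \<ge> k)"
proof -
  have "path_prob m (\<lambda>xs :: (int ^ 'd) list. visits xs 0 \<ge> k) =
      path_prob n (\<lambda>xs :: (int ^ 'd) list. visits (take m xs) 0 \<ge> k)"
    using path_mean_take[OF assms, of "\<lambda>xs :: (int ^ 'd) list. of_bool (visits xs 0 \<ge> k)"] by simp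
  also have "\<dots> \<le> path_prob n (\<lambda>xs :: (int ^ 'd) list. visits xs 0 \<ge> k)"
    by (rule path_prob_mono) (meson le_trans visits_take_le)
  finally show ?thesis .
qed

text \<open>A sequence of \<open>m\<close> returns is a chain of \<open>m\<close> successive first returns, each of probability at most
  \<open>\<beta>\<close>.\<close>

lemma path_prob_visits_le:
  assumes "\<And>n. return_prob TYPE('d) n \<le> \<beta>"
  shows "path_prob n (\<lambda>xs :: (int ^ 'd) list. visits xs 0 \<ge> m) \<le> \<beta> ^ m"
proof (induction m arbitrary: n)
  case (Suc m)
  have \<beta>: "\<beta> \<ge> 0"
    by (rule order_trans[OF path_prob_nonneg assms[of 0]])
  have "path_prob n (\<lambda>xs :: (int ^ 'd) list. visits xs 0 \<ge> Suc m) \<le>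
      (\<Sum>j\<in>{0<..n}. path_prob j (first_hit 0 {0 :: int ^ 'd}) * \<beta> ^ m)"
    unfolding path_prob_visits_Suc by (intro sum_mono mult_left_mono Suc path_prob_nonneg)
  also have "\<dots> = return_prob TYPE('d) n * \<beta> ^ m"
    unfolding hit_prob_eq_sum by (simp add: sum_distrib_right)
  also have "\<dots> \<le> \<beta> * \<beta> ^ m"
    using assms \<beta> by (intro mult_right_mono) auto
  finally show ?case by simp
qed (simp add: path_prob_le_one)

text \<open>It suffices that each of the \<open>m\<close> returns happens within \<open>s\<close> steps of the previous one.\<close>

lemma path_prob_visits_ge:
  "return_prob TYPE('d) s ^ m \<le> path_prob (m * s) (\<lambda>xs :: (int ^ 'd) list. visits xs 0 \<ge> m)"
proof (induction m)
  case (Suc m)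
  let ?p = "\<lambda>n. path_prob n (\<lambda>xs :: (int ^ 'd) list. visits xs 0 \<ge> m)"
  have "return_prob TYPE('d) s ^ Suc m \<le> return_prob TYPE('d) s * ?p (m * s)"
    using Suc path_prob_nonneg by (auto intro!: mult_left_mono)
  also have "\<dots> = (\<Sum>j\<in>{0<..s}. path_prob j (first_hit 0 {0 :: int ^ 'd}) * ?p (m * s))"
    unfolding hit_prob_eq_sum by (simp add: sum_distrib_right)
  also have "\<dots> \<le> (\<Sum>j\<in>{0<..s}. path_prob j (first_hit 0 {0 :: int ^ 'd}) * ?p (Suc m * s - j))"
    by (intro sum_mono mult_left_mono path_prob_visits_mono path_prob_nonneg) auto
  also have "\<dots> \<le> (\<Sum>j\<in>{0<..Suc m * s}.
      path_prob j (first_hit 0 {0 :: int ^ 'd}) * ?p (Suc m * s - j))"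
    by (intro sum_mono2) (auto intro!: mult_nonneg_nonneg path_prob_nonneg)
  finally show ?case unfolding path_prob_visits_Suc .
qed simp

text \<open>A point with more than \<open>m\<close> visits is first visited at some time \<open>j\<close> and then visited \<open>m\<close> times by
  the walk started afresh at time \<open>j\<close>. The union bound over all \<open>j\<close> at which the walk is in \<open>A\<close> does
  not lose much, since a typical point is visited a bounded number of times.\<close>

lemma path_prob_exists_visits_le:
  fixes A :: "(int ^ 'd) set"
  assumes "\<And>n. return_prob TYPE('d) n \<le> \<beta>"
  shows "path_prob n (\<lambda>xs. \<exists>x\<in>A. visits xs x \<ge> Suc m) \<le>
    (\<Sum>j\<in>{0<..n}. path_prob j (\<lambda>xs. sum_list xs \<in> A)) * \<beta> ^ m"
proof -
  have "path_prob n (\<lambda>xs. \<exists>x\<in>A. visits xs x \<ge> Suc m) \<le>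
      path_mean n (\<lambda>xs. \<Sum>j\<in>{0<..n}. of_bool (sum_list (take j xs) \<in> A) *
        of_bool (visits (drop j xs) 0 \<ge> m))"
  proof (rule path_mean_mono)
    fix xs :: "(int ^ 'd) list" assume xs: "length xs = n"
    show "of_bool (\<exists>x\<in>A. visits xs x \<ge> Suc m) \<le> (\<Sum>j\<in>{0<..n}.
      of_bool (sum_list (take j xs) \<in> A) * of_bool (visits (drop j xs) 0 \<ge> m) :: real)"
    proof (cases "\<exists>x\<in>A. visits xs x \<ge> Suc m")
      case True
      then obtain x where x: "x \<in> A" "visits xs x \<ge> Suc m" by blast
      then have "{j \<in> {1..length xs}. sum_list (take j xs) = x} \<noteq> {}"
        unfolding visits_def by (metis card.empty not_less_eq_eq zero_le)
      then obtain i where i: "i \<in> {0<..length xs}" "sum_list (take i xs) \<in> {x}"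
        by (auto simp: Suc_le_eq)
      from first_hit_exists[OF i] obtain j where "j \<in> {0<..i}" "first_hit 0 {x} (take j xs)" ..
      then have j: "j \<in> {0<..n}" "first_hit 0 {x} (take j xs)" using i(1) xs by simp_all
      have "visits (take j xs) x = 1" and jx: "sum_list (take j xs) = x"
        using visits_first_hit[OF j(2)] j(2) by (simp_all add: first_hit_def)
      then have "visits (drop j xs) 0 \<ge> m"
        using visits_take_drop[of xs x j] x by simp
      with jx x have "of_bool (\<exists>x\<in>A. visits xs x \<ge> Suc m) \<le>
          (of_bool (sum_list (take j xs) \<in> A) * of_bool (visits (drop j xs) 0 \<ge> m) :: real)"
        by simp
      also have "\<dots> \<le> (\<Sum>j\<in>{0<..n}.
          of_bool (sum_list (take j xs) \<in> A) * of_bool (visits (drop j xs) 0 \<ge> m))"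
        using j by (intro member_le_sum) auto
      finally show ?thesis .
    qed (auto intro!: sum_nonneg)
  qed
  also have "\<dots> = (\<Sum>j\<in>{0<..n}. path_mean n (\<lambda>xs. of_bool (sum_list (take j xs) \<in> A) *
        of_bool (visits (drop j xs) 0 \<ge> m)))"
    unfolding path_mean_sum ..
  also have "\<dots> = (\<Sum>j\<in>{0<..n}. path_prob j (\<lambda>xs. sum_list xs \<in> A) *
      path_prob (n - j) (\<lambda>xs :: (int ^ 'd) list. visits xs 0 \<ge> m))"
    by (intro sum.cong refl path_mean_take_drop[where f = "\<lambda>xs. of_bool (sum_list xs \<in> A)"
      and g = "\<lambda>xs. of_bool (visits xs 0 \<ge> m)"]) auto
  also have "\<dots> \<le> (\<Sum>j\<in>{0<..n}. path_prob j (\<lambda>xs. sum_list xs \<in> A) * \<beta> ^ m)"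
    by (intro sum_mono mult_left_mono path_prob_visits_le assms path_prob_nonneg)
  finally show ?thesis by (simp add: sum_distrib_right)
qed

section \<open>Repeated attempts\<close>

text \<open>A last-exit argument. Consider the events, for \<open>j \<le> N\<close>, that the walk is in \<open>A\<close> at time \<open>j\<close> and
  not in \<open>A\<close> at the times in \<open>{j + w<..j + N}\<close>. If the first of them to occur has index \<open>j\<close>, then
  all others that occur have index at most \<open>j + w\<close>, so at most \<open>w + 1\<close> of them occur together.
  For an additive subgroup \<open>A\<close> the Markov property turns the sum of their probabilities
  into the product on the left.\<close>

lemma hitting_mass_times_avoidance_le:
  fixes A :: "(int ^ 'd) set"
  assumes sub: "\<And>x y. x \<in> A \<Longrightarrow> x + y \<in> A \<longleftrightarrow> y \<in> A"
  shows "(\<Sum>j\<le>N. path_prob j (\<lambda>xs. sum_list xs \<in> A)) *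
    path_prob N (\<lambda>xs. \<not> (\<exists>i\<in>{w<..N}. sum_list (take i xs) \<in> A)) \<le> real (w + 1)"
proof -
  let ?no = "\<lambda>xs :: (int ^ 'd) list. \<not> (\<exists>i\<in>{w<..N}. sum_list (take i xs) \<in> A)"
  let ?E = "\<lambda>j xs. sum_list (take j xs) \<in> A \<and> ?no (drop j xs)"
  have "path_prob j (\<lambda>xs. sum_list xs \<in> A) * path_prob N ?no = path_prob (2 * N) (?E j)"
    if j: "j \<le> N" for j
  proof -
    have "path_prob (2 * N - j) ?no = path_prob (2 * N - j) (\<lambda>xs. ?no (take N xs))"
      by (simp add: min_absorb1)
    also have "\<dots> = path_prob N ?no"
      using j by (intro path_mean_take[where f = "\<lambda>xs. of_bool (?no xs)"]) auto
    finally have "path_prob j (\<lambda>xs. sum_list xs \<in> A) * path_prob N ?no =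
        path_prob j (\<lambda>xs. sum_list xs \<in> A) * path_prob (2 * N - j) ?no" by simp
    also have "\<dots> = path_mean (2 * N)
        (\<lambda>xs. of_bool (sum_list (take j xs) \<in> A) * of_bool (?no (drop j xs)))"
      using j by (intro path_mean_take_drop[where f = "\<lambda>xs. of_bool (sum_list xs \<in> A)"
        and g = "\<lambda>xs. of_bool (?no xs)", symmetric]) auto
    finally show ?thesis by (simp only: of_bool_conj)
  qed
  then have "(\<Sum>j\<le>N. path_prob j (\<lambda>xs. sum_list xs \<in> A)) * path_prob N ?no =
      (\<Sum>j\<le>N. path_prob (2 * N) (?E j))"
    unfolding sum_distrib_right by (intro sum.cong) auto
  also have "\<dots> = path_mean (2 * N) (\<lambda>xs. \<Sum>j\<le>N. of_bool (?E j xs))"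
    unfolding path_mean_sum ..
  also have "\<dots> \<le> path_mean (2 * N) (\<lambda>_ :: (int ^ 'd) list. real (w + 1))"
  proof (rule path_mean_mono)
    fix xs :: "(int ^ 'd) list"
    define J where "J = {j. j \<le> N \<and> ?E j xs}"
    have J: "finite J" unfolding J_def by simp
    have "card J \<le> w + 1"
    proof (cases "J = {}")
      case False
      define m where "m = Min J"
      have m: "m \<in> J" and min: "\<And>j. j \<in> J \<Longrightarrow> m \<le> j"
        using J False unfolding m_def by auto
      have "J \<subseteq> {m..m + w}"
      proof
        fix j assume j: "j \<in> J"
        have "\<not> m + w < j"
        proof
          assume l: "m + w < j"
          have "take j xs = take m xs @ take (j - m) (drop m xs)"
            using take_add[of m "j - m" xs] l by simp
          then have "sum_list (take m xs) + sum_list (take (j - m) (drop m xs)) \<in> A"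
            using j unfolding J_def by simp
          then have "sum_list (take (j - m) (drop m xs)) \<in> A"
            using sub m unfolding J_def by blast
          moreover have "j - m \<in> {w<..N}"
            using l j unfolding J_def by auto
          ultimately show False using m unfolding J_def by blast
        qed
        with min[OF j] show "j \<in> {m..m + w}" by simp
      qed
      from card_mono[OF _ this] show ?thesis by simp
    qed simp
    moreover have "(\<Sum>j\<le>N. of_bool (?E j xs)) = real (card ({..N} \<inter> {j. ?E j xs}))"
      by (rule sum_of_bool_eq) simp_all
    moreover have "{..N} \<inter> {j. ?E j xs} = J"
      unfolding J_def by blast
    ultimately show "(\<Sum>j\<le>N. of_bool (?E j xs)) \<le> real (w + 1)"
      by simp
  qed
  finally show ?thesis by simp
qed

definition fail_prob :: "(int ^ 'd) set \<Rightarrow> nat \<Rightarrow> nat \<Rightarrow> real"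
  where "fail_prob A k n = path_prob n (\<lambda>xs. \<not> (\<exists>x\<in>A. k \<le> visits xs x))"

lemma fail_prob_antimono:
  assumes "m \<le> n"
  shows "fail_prob A k n \<le> fail_prob A k m"
proof -
  have "fail_prob A k n \<le> path_prob n (\<lambda>xs. \<not> (\<exists>x\<in>A. k \<le> visits (take m xs) x))"
    unfolding fail_prob_def by (rule path_prob_mono) (meson le_trans visits_take_le)
  also have "\<dots> = fail_prob A k m"
    unfolding fail_prob_def using assms
    by (intro path_mean_take[where f = "\<lambda>xs. of_bool (\<not> (\<exists>x\<in>A. k \<le> visits xs x))"])
  finally show ?thesis .
qed

text \<open>One attempt: the walk starts in \<open>A\<close> and has \<open>w\<close> steps to return \<open>k\<close> times to its start. If it
  fails, it starts afresh at the first time after \<open>w\<close> at which it is in \<open>A\<close>, and this time is at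
  most \<open>N\<close> unless the first event on the right occurs.\<close>

lemma fail_prob_step:
  fixes A :: "(int ^ 'd) set"
  assumes sub: "\<And>x y. x \<in> A \<Longrightarrow> x + y \<in> A \<longleftrightarrow> y \<in> A" and zero: "0 \<in> A"
    and "w \<le> N" "N \<le> n"
  shows "fail_prob A k n \<le>
    path_prob N (\<lambda>xs. \<not> (\<exists>i\<in>{w<..N}. sum_list (take i xs) \<in> A)) +
    (1 - path_prob w (\<lambda>xs :: (int ^ 'd) list. k \<le> visits xs 0)) * fail_prob A k (n - N)"
proof -
  let ?fail = "\<lambda>xs. \<not> (\<exists>x\<in>A. k \<le> visits xs x)"
  let ?no = "\<lambda>xs :: (int ^ 'd) list. \<not> (\<exists>i\<in>{w<..N}. sum_list (take i xs) \<in> A)"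
  let ?bad = "\<lambda>xs :: (int ^ 'd) list. \<not> k \<le> visits (take w xs) 0"
  let ?f = "\<lambda>xs :: (int ^ 'd) list. of_bool (?bad xs) * of_bool (first_hit w A xs) :: real"
  have pointwise: "of_bool (?fail xs) \<le> of_bool (?no (take N xs)) +
      (\<Sum>j\<in>{w<..N}. ?f (take j xs) * of_bool (?fail (drop j xs)))"
    if n: "length xs = n" for xs :: "(int ^ 'd) list"
  proof (cases "?fail xs \<and> \<not> ?no (take N xs)")
    case True
    then obtain i where i: "i \<in> {w<..N}" "sum_list (take i (take N xs)) \<in> A" by blast
    have "i \<in> {w<..length xs}" "sum_list (take i xs) \<in> A"
      using i n assms by (auto simp: min_absorb1)
    from first_hit_exists[OF this]
    obtain j where "j \<in> {w<..i}" "first_hit w A (take j xs)" ..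
    then have j: "j \<in> {w<..N}" "first_hit w A (take j xs)" using i(1) by simp_all
    have jA: "sum_list (take j xs) \<in> A"
      using j(2) by (simp add: first_hit_def)
    have "visits (take w xs) 0 \<le> visits xs 0"
      by (rule visits_take_le)
    then have 1: "?bad (take j xs)"
      using True zero j(1) by (auto simp: min_absorb1)
    have "\<not> k \<le> visits (drop j xs) x" if "x \<in> A" for x
    proof -
      have "sum_list (take j xs) + x \<in> A" using sub jA that by blast
      then have "\<not> k \<le> visits xs (sum_list (take j xs) + x)" using True by blast
      with visits_drop_le[of j xs x] show ?thesis by simp
    qed
    then have "?fail (drop j xs)" by blast
    with 1 j(2) have "of_bool (?fail xs) \<le> ?f (take j xs) * of_bool (?fail (drop j xs))"
      by simp
    also have "\<dots> \<le> (\<Sum>j\<in>{w<..N}. ?f (take j xs) * of_bool (?fail (drop j xs)))"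
      using j(1)
      by (intro member_le_sum[where f = "\<lambda>j. ?f (take j xs) * of_bool (?fail (drop j xs))"]) auto
    finally show ?thesis by (rule add_increasing[OF zero_less_eq_of_bool])
  next
    case False
    then have "of_bool (?fail xs) \<le> (of_bool (?no (take N xs)) :: real)"
      by (auto simp: of_bool_def)
    moreover have "0 \<le> (\<Sum>j\<in>{w<..N}. ?f (take j xs) * of_bool (?fail (drop j xs)))"
      by (intro sum_nonneg mult_nonneg_nonneg) simp_all
    ultimately show ?thesis by (rule add_increasing2[rotated])
  qed
  have "fail_prob A k n \<le> path_mean n (\<lambda>xs. of_bool (?no (take N xs)) +
      (\<Sum>j\<in>{w<..N}. ?f (take j xs) * of_bool (?fail (drop j xs))))"
    unfolding fail_prob_def by (rule path_mean_mono, rule pointwise)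
  also have "\<dots> = path_prob N ?no +
      (\<Sum>j\<in>{w<..N}. path_mean n (\<lambda>xs. ?f (take j xs) * of_bool (?fail (drop j xs))))"
    unfolding path_mean_add path_mean_sum
    using path_mean_take[OF \<open>N \<le> n\<close>, of "\<lambda>xs. of_bool (?no xs)"] by (rule arg_cong2) (rule refl)
  also have "(\<Sum>j\<in>{w<..N}. path_mean n (\<lambda>xs. ?f (take j xs) * of_bool (?fail (drop j xs)))) =
      (\<Sum>j\<in>{w<..N}. path_mean j ?f * fail_prob A k (n - j))"
    unfolding fail_prob_def using \<open>N \<le> n\<close>
    by (intro sum.cong refl path_mean_take_drop[where f = ?f and g = "\<lambda>xs. of_bool (?fail xs)"]) auto
  also have "\<dots> \<le> (\<Sum>j\<in>{w<..N}. path_mean j ?f * fail_prob A k (n - N))"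
  proof (intro sum_mono mult_left_mono)
    fix j assume "j \<in> {w<..N}"
    then show "fail_prob A k (n - j) \<le> fail_prob A k (n - N)"
      by (intro fail_prob_antimono) auto
    show "0 \<le> path_mean j ?f"
      using path_mean_mono[of j "\<lambda>_. 0" ?f] by simp
  qed
  also have "\<dots> = (\<Sum>j\<in>{w<..N}. path_mean j ?f) * fail_prob A k (n - N)"
    by (rule sum_distrib_right[symmetric])
  also have "\<dots> \<le> (1 - path_prob w (\<lambda>xs :: (int ^ 'd) list. k \<le> visits xs 0)) * fail_prob A k (n - N)"
  proof (rule mult_right_mono)
    have "(\<Sum>j\<in>{w<..N}. path_mean j ?f) = (\<Sum>j\<in>{w<..N}. path_mean N (\<lambda>xs. ?f (take j xs)))"
      by (intro sum.cong refl path_mean_take[where f = ?f, symmetric]) auto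
    also have "\<dots> = path_mean N (\<lambda>xs. \<Sum>j\<in>{w<..N}. ?f (take j xs))"
      unfolding path_mean_sum ..
    also have "\<dots> \<le> path_prob N ?bad"
    proof (rule path_mean_mono)
      fix xs :: "(int ^ 'd) list" assume N: "length xs = N"
      have "(\<Sum>j\<in>{w<..N}. ?f (take j xs)) =
          (\<Sum>j\<in>{w<..N}. of_bool (?bad xs) * of_bool (first_hit w A (take j xs)))"
        by (intro sum.cong) (auto simp: min_absorb1)
      also have "\<dots> = of_bool (?bad xs) * (\<Sum>j\<in>{w<..N}. of_bool (first_hit w A (take j xs)))"
        by (rule sum_distrib_left[symmetric])
      also have "\<dots> \<le> of_bool (?bad xs) * 1"
        unfolding N[symmetric] sum_of_bool_first_hit by (rule mult_left_mono) auto
      finally show "(\<Sum>j\<in>{w<..N}. ?f (take j xs)) \<le> of_bool (?bad xs)" by simp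
    qed
    also have "\<dots> = path_prob w (\<lambda>xs :: (int ^ 'd) list. \<not> k \<le> visits xs 0)"
      using \<open>w \<le> N\<close>
      by (intro path_mean_take[where f = "\<lambda>xs. of_bool (\<not> k \<le> visits xs 0)"])
    also have "\<dots> = 1 - path_prob w (\<lambda>xs :: (int ^ 'd) list. k \<le> visits xs 0)"
      by (rule path_prob_not)
    finally show "(\<Sum>j\<in>{w<..N}. path_mean j ?f) \<le>
        1 - path_prob w (\<lambda>xs :: (int ^ 'd) list. k \<le> visits xs 0)" .
    show "0 \<le> fail_prob A k (n - N)"
      unfolding fail_prob_def by (rule path_prob_nonneg)
  qed
  finally show ?thesis by simp
qed

text \<open>The solution of the recursion \<open>F (m + 1) \<le> r + (1 - p) * F m\<close> given by
  \<open>fail_prob_step\<close>. The bound \<open>r / p\<close> does not grow with the number of attempts.\<close>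

lemma fail_prob_le:
  fixes A :: "(int ^ 'd) set"
  assumes sub: "\<And>x y. x \<in> A \<Longrightarrow> x + y \<in> A \<longleftrightarrow> y \<in> A" and zero: "0 \<in> A" and "w \<le> N"
  defines "r \<equiv> path_prob N (\<lambda>xs. \<not> (\<exists>i\<in>{w<..N}. sum_list (take i xs) \<in> A))"
  assumes p: "0 < p" "p \<le> path_prob w (\<lambda>xs :: (int ^ 'd) list. k \<le> visits xs 0)"
  shows "fail_prob A k (m * N) \<le> r / p + (1 - p) ^ m"
proof (induction m)
  case 0
  have "r \<ge> 0" unfolding r_def by (rule path_prob_nonneg)
  moreover have "fail_prob A k 0 \<le> 1"
    unfolding fail_prob_def by (rule path_prob_le_one)
  moreover have "0 \<le> r / p" using p \<open>r \<ge> 0\<close> by simp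
  ultimately show ?case by simp
next
  case (Suc m)
  have p1: "p \<le> 1" by (rule order_trans[OF p(2) path_prob_le_one])
  have nonneg: "0 \<le> fail_prob A k (m * N)"
    unfolding fail_prob_def by (rule path_prob_nonneg)
  have "fail_prob A k (Suc m * N) \<le>
      r + (1 - path_prob w (\<lambda>xs :: (int ^ 'd) list. k \<le> visits xs 0)) * fail_prob A k (m * N)"
    using fail_prob_step[OF sub zero \<open>w \<le> N\<close>, of "Suc m * N" k] unfolding r_def by simp
  also have "\<dots> \<le> r + (1 - p) * fail_prob A k (m * N)"
    using p nonneg by (intro add_left_mono mult_right_mono) auto
  also have "\<dots> \<le> r + (1 - p) * (r / p + (1 - p) ^ m)"
    using Suc p1 by (intro add_left_mono mult_left_mono) auto
  also have "\<dots> = r / p + (1 - p) ^ Suc m"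
    using p by (simp add: field_simps)
  finally show ?case .
qed

section \<open>Transience and the logarithmic upper bound, by subharmonic functions\<close>

text \<open>The coefficient of \<open>h ^ 4\<close> in the Taylor series is \<open>- 1 / 4\<close>, so there is room to spare near 0.\<close>

lemma ln_ge_quartic:
  "\<exists>\<delta>>0. \<forall>h::real. \<bar>h\<bar> < \<delta> \<longrightarrow> h - h\<^sup>2 / 2 + h ^ 3 / 3 - h ^ 4 / 2 \<le> ln (1 + h)"
proof -
  have "eventually (\<lambda>h::real. h - h\<^sup>2 / 2 + h ^ 3 / 3 - h ^ 4 / 2 \<le> ln (1 + h)) (at_right 0)"
    by real_asymp
  moreover have "eventually (\<lambda>h::real. h - h\<^sup>2 / 2 + h ^ 3 / 3 - h ^ 4 / 2 \<le> ln (1 + h)) (at_left 0)"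
    by real_asymp
  ultimately have "eventually (\<lambda>h::real. h - h\<^sup>2 / 2 + h ^ 3 / 3 - h ^ 4 / 2 \<le> ln (1 + h)) (at 0)"
    by (simp add: eventually_at_split)
  then obtain \<delta> where \<delta>: "\<delta> > 0"
    "\<And>h::real. h \<noteq> 0 \<Longrightarrow> dist h 0 < \<delta> \<Longrightarrow> h - h\<^sup>2 / 2 + h ^ 3 / 3 - h ^ 4 / 2 \<le> ln (1 + h)"
    unfolding eventually_at by auto
  then have "h - h\<^sup>2 / 2 + h ^ 3 / 3 - h ^ 4 / 2 \<le> ln (1 + h)" if "\<bar>h\<bar> < \<delta>" for h :: real
    using that \<delta>(2)[of h] by (cases "h = 0") auto
  with \<delta>(1) show ?thesis by blast
qed

text \<open>The coefficient of \<open>h\<^sup>2\<close> in the Taylor series is \<open>9 / 128\<close>. The value \<open>11 / 128\<close> leaves room for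
  the remainder but is below \<open>12 / 128\<close>, which would make the drift vanish in dimension three
  (see \<open>norm_sq_bounded_subharmonic\<close>).\<close>

lemma powr_minus_eighth_le_quadratic:
  "\<exists>\<delta>>0. \<forall>h::real. \<bar>h\<bar> < \<delta> \<longrightarrow> (1 + h) powr (- 1 / 8) \<le> 1 - h / 8 + 11 / 128 * h\<^sup>2"
proof -
  have "eventually (\<lambda>h::real. (1 + h) powr (- 1 / 8) \<le> 1 - h / 8 + 11 / 128 * h\<^sup>2) (at_right 0)"
    by real_asymp
  moreover have "eventually (\<lambda>h::real. (1 + h) powr (- 1 / 8) \<le> 1 - h / 8 + 11 / 128 * h\<^sup>2) (at_left 0)"
    by real_asymp
  ultimately have "eventually (\<lambda>h::real. (1 + h) powr (- 1 / 8) \<le> 1 - h / 8 + 11 / 128 * h\<^sup>2) (at 0)"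
    by (simp add: eventually_at_split)
  then obtain \<delta> where \<delta>: "\<delta> > 0"
    "\<And>h::real. h \<noteq> 0 \<Longrightarrow> dist h 0 < \<delta> \<Longrightarrow> (1 + h) powr (- 1 / 8) \<le> 1 - h / 8 + 11 / 128 * h\<^sup>2"
    unfolding eventually_at by auto
  then have "(1 + h) powr (- 1 / 8) \<le> 1 - h / 8 + 11 / 128 * h\<^sup>2" if "\<bar>h\<bar> < \<delta>" for h :: real
    using that \<delta>(2)[of h] by (cases "h = 0") auto
  with \<delta>(1) show ?thesis by blast
qed

text \<open>The mean of a subharmonic function along the walk increases by at least \<open>c\<close> times the probability
  of being in \<open>A\<close>, so upper bounds on this mean bound the expected number of visits to \<open>A\<close>.\<close>

lemma drift_bound:
  fixes \<phi> :: "int ^ 'd \<Rightarrow> real"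
  assumes "\<And>x. \<phi> x + c * of_bool (x \<in> A) \<le> (\<Sum>v\<in>unit_steps. \<phi> (x + v)) / (2 * real CARD('d))"
  shows "\<phi> 0 + c * (\<Sum>j<n. path_prob j (\<lambda>xs. sum_list xs \<in> A)) \<le> path_mean n (\<lambda>xs. \<phi> (sum_list xs))"
proof (induction n)
  case (Suc n)
  have "\<phi> 0 + c * (\<Sum>j<Suc n. path_prob j (\<lambda>xs. sum_list xs \<in> A)) \<le>
      path_mean n (\<lambda>xs. \<phi> (sum_list xs)) + c * path_prob n (\<lambda>xs. sum_list xs \<in> A)"
    using Suc by (simp add: algebra_simps)
  also have "\<dots> = path_mean n (\<lambda>xs. \<phi> (sum_list xs) + c * of_bool (sum_list xs \<in> A))"
    unfolding path_mean_add path_mean_cmult ..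
  also have "\<dots> \<le> path_mean n (\<lambda>xs. (\<Sum>v\<in>unit_steps. \<phi> (sum_list xs + v)) / (2 * real CARD('d)))"
    by (rule path_mean_mono) (rule assms)
  also have "\<dots> = path_mean (n + Suc 0) (\<lambda>xs. \<phi> (sum_list xs))"
    unfolding path_mean_append[of n "Suc 0"] by simp
  finally show ?case by simp
qed simp

definition real_vec :: "int ^ 'd \<Rightarrow> real ^ 'd"
  where "real_vec x = (\<chi> i. real_of_int (x $ i))"

lemma real_vec_add: "real_vec (x + y) = real_vec x + real_vec y"
  by (simp add: real_vec_def vec_eq_iff)

lemma real_vec_zero [simp]: "real_vec 0 = 0"
  by (simp add: real_vec_def vec_eq_iff)

lemma real_vec_axis: "real_vec (axis i 1) = axis i 1" "real_vec (- axis i 1) = - axis i 1"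
  by (auto simp: real_vec_def vec_eq_iff axis_def)

lemma norm_sum_unit_steps_le:
  assumes "set xs \<subseteq> unit_steps"
  shows "norm (real_vec (sum_list xs)) \<le> real (length xs)"
  using assms
proof (induction xs)
  case (Cons v xs)
  then have "norm (real_vec v) = 1"
    by (auto simp: unit_steps_def real_vec_axis)
  moreover have "norm (real_vec (sum_list xs)) \<le> real (length xs)"
    using Cons by simp
  moreover have "norm (real_vec (v + sum_list xs)) \<le> norm (real_vec v) + norm (real_vec (sum_list xs))"
    unfolding real_vec_add by (rule norm_triangle_ineq)
  ultimately show ?case by simp
qed simp

text \<open>For a step along a coordinate axis, \<open>s \<plusminus> 2 * p\<close> is the change of a squared norm, where \<open>p\<close> is the
  inner product of the position and the step; it is small relative to \<open>R\<close>, the squared norm plus a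
  large constant, so that the Taylor estimates apply.\<close>

lemma increment_over_norm_small:
  fixes R p s \<delta> :: real
  assumes "\<delta> > 0" "R \<ge> 1" "R \<ge> (5 / \<delta>)\<^sup>2" "p\<^sup>2 \<le> R" "0 \<le> s" "s \<le> 2"
  shows "\<bar>(2 * p + s) / R\<bar> < \<delta>" "\<bar>(s - 2 * p) / R\<bar> < \<delta>"
proof -
  have r: "sqrt R \<ge> 1" "sqrt R \<ge> 5 / \<delta>" "\<bar>p\<bar> \<le> sqrt R"
    using assms by (auto simp: real_le_rsqrt intro: real_le_rsqrt)
  then have "\<bar>2 * p + s\<bar> \<le> 4 * sqrt R" "\<bar>s - 2 * p\<bar> \<le> 4 * sqrt R"
    using assms by linarith+
  moreover have "4 * sqrt R < \<delta> * R"
  proof -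
    have "5 \<le> \<delta> * sqrt R" using r(2) assms(1) by (simp add: field_simps)
    then have "5 * sqrt R \<le> \<delta> * sqrt R * sqrt R"
      using r(1) by (intro mult_right_mono) auto
    moreover have "sqrt R * sqrt R = R" using assms by simp
    ultimately have "5 * sqrt R \<le> \<delta> * R" by (simp add: mult.assoc)
    with r(1) show ?thesis by linarith
  qed
  ultimately have "\<bar>2 * p + s\<bar> < \<delta> * R" "\<bar>s - 2 * p\<bar> < \<delta> * R" by linarith+
  then show "\<bar>(2 * p + s) / R\<bar> < \<delta>" "\<bar>(s - 2 * p) / R\<bar> < \<delta>"
    using assms by (simp_all add: abs_divide field_simps)
qed

lemma norm_sq_sum: "(norm (x :: real ^ 'd))\<^sup>2 = (\<Sum>i\<in>UNIV. (x $ i)\<^sup>2)"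
  by (simp add: norm_vec_def L2_set_def sum_nonneg)

text \<open>With \<open>R = \<bar>x\<bar>\<^sup>2 + C\<close>, a step \<open>\<plusminus> axis i 1\<close> multiplies \<open>R\<close> by \<open>1 + h\<close> with \<open>h = (1 \<plusminus> 2 * x $ i) / R\<close>.
  The average of \<open>h\<close> is \<open>1 / R\<close>, and that of \<open>h\<^sup>2\<close> is at most \<open>4 / (d * R)\<close> up to order
  \<open>1 / R\<^sup>2\<close>. By the quadratic Taylor estimate, the relative decrease of the average of
  \<open>R powr (- 1 / 8)\<close> is at least \<open>(1 / 8 - 11 / (32 * d)) / R\<close> up to order
  \<open>1 / R\<^sup>2\<close>, which is positive for \<open>d \<ge> 3\<close> and \<open>C\<close> large.\<close>

lemma norm_sq_bounded_subharmonic: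
  assumes d: "CARD('d) \<ge> 3"
  shows "\<exists>C c. C \<ge> 1 \<and> c > 0 \<and> (\<forall>x :: int ^ 'd.
    - (((norm (real_vec x))\<^sup>2 + C) powr (- 1 / 8)) + c * of_bool (x \<in> {0}) \<le>
    (\<Sum>v\<in>unit_steps. - (((norm (real_vec (x + v)))\<^sup>2 + C) powr (- 1 / 8))) / (2 * real CARD('d)))"
proof -
  obtain \<delta> :: real where \<delta>: "\<delta> > 0"
    "\<And>h. \<bar>h\<bar> < \<delta> \<Longrightarrow> (1 + h) powr (- 1 / 8) \<le> 1 - h / 8 + 11 / 128 * h\<^sup>2"
    using powr_minus_eighth_le_quadratic by blast
  define D where "D = real CARD('d)"
  have D: "D \<ge> 3" using d by (simp add: D_def)
  define C where "C = max 10 (max 1 ((5 / \<delta>)\<^sup>2))"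
  have C: "C \<ge> 10" "C \<ge> 1" "C \<ge> (5 / \<delta>)\<^sup>2" by (auto simp: C_def)
  \<comment> \<open>a lower bound for the relative decrease of \<open>R powr (- 1 / 8)\<close>; as \<open>1 /
    4 - 1 / 48 = 11 / 48\<close>, the term \<open>D / (4 * R)\<close> exceeds the loss \<open>11 / (16 *
    R)\<close> by at least \<open>D / (48 * R)\<close> if \<open>D \<ge> 3\<close>\<close>
  define gain where "gain R = (D / 48 / R - 11 * D / 64 / R\<^sup>2) / (2 * D)" for R :: real
  have gain: "gain R > 0" if "R \<ge> 10" for R
  proof -
    have "11 * D / 64 / R\<^sup>2 = (11 * D / 64 / R) / R" using that by (simp add: power2_eq_square)
    also have "\<dots> \<le> (11 * D / 64 / R) / 10" using that D by (intro divide_left_mono) auto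
    also have "\<dots> < D / 48 / R" using that D by (simp add: field_simps)
    finally show ?thesis unfolding gain_def using D by simp
  qed
  have step: "(\<Sum>v\<in>unit_steps. - (((norm (real_vec (x + v)))\<^sup>2 + C) powr (- 1 / 8))) / (2 * D) \<ge>
      - (((norm (real_vec x))\<^sup>2 + C) powr (- 1 / 8)) * (1 - gain ((norm (real_vec x))\<^sup>2 + C))"
    for x :: "int ^ 'd"
  proof -
    define R where "R = (norm (real_vec x))\<^sup>2 + C"
    have R: "R \<ge> 10" "R \<ge> 1" "R \<ge> (5 / \<delta>)\<^sup>2" using C by (auto simp: R_def intro: add_increasing)
    let ?p = "\<lambda>i. real_vec x $ i"
    have p: "(?p i)\<^sup>2 \<le> R" for i
    proof -
      have "\<bar>?p i\<bar> \<le> norm (real_vec x)" by (rule component_le_norm_cart)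
      then have "(?p i)\<^sup>2 \<le> (norm (real_vec x))\<^sup>2" by (rule abs_le_square_iff[THEN iffD1, of "?p i" "norm (real_vec x)", simplified])
      then show ?thesis using C by (simp add: R_def)
    qed
    have plus: "(norm (real_vec (x + axis i 1)))\<^sup>2 + C = R * (1 + (2 * ?p i + 1) / R)"
      and minus: "(norm (real_vec (x + - axis i 1)))\<^sup>2 + C = R * (1 + (1 - 2 * ?p i) / R)" for i
    proof -
      have "(norm (real_vec x + axis i 1))\<^sup>2 = (norm (real_vec x))\<^sup>2 + 2 * ?p i + 1"
        "(norm (real_vec x - axis i 1))\<^sup>2 = (norm (real_vec x))\<^sup>2 - 2 * ?p i + 1"
        by (simp_all add: power2_norm_eq_inner inner_add inner_diff inner_axis inner_axis' algebra_simps)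
      moreover have "R * (1 + y / R) = R + y" for y using R by (simp add: field_simps)
      ultimately show "(norm (real_vec (x + axis i 1)))\<^sup>2 + C = R * (1 + (2 * ?p i + 1) / R)"
        "(norm (real_vec (x + - axis i 1)))\<^sup>2 + C = R * (1 + (1 - 2 * ?p i) / R)"
        unfolding real_vec_add real_vec_axis by (simp_all add: R_def)
    qed
    have pair: "((norm (real_vec (x + axis i 1)))\<^sup>2 + C) powr (- 1 / 8) +
        ((norm (real_vec (x + - axis i 1)))\<^sup>2 + C) powr (- 1 / 8) \<le>
        R powr (- 1 / 8) * (2 - 1 / (4 * R) + 11 / 64 / R\<^sup>2 * (4 * (?p i)\<^sup>2 + 1))" for i
    proof -
      let ?h = "(2 * ?p i + 1) / R" and ?k = "(1 - 2 * ?p i) / R"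
      have h: "\<bar>?h\<bar> < \<delta>" "\<bar>?k\<bar> < \<delta>"
        using increment_over_norm_small[OF \<delta>(1) R(2,3) p[of i], of 1] by simp_all
      have pos: "1 + ?h \<ge> 0" "1 + ?k \<ge> 0"
      proof -
        have "R * (1 + ?h) \<ge> 0" "R * (1 + ?k) \<ge> 0"
          unfolding plus[symmetric] minus[symmetric] using C by simp_all
        then show "1 + ?h \<ge> 0" "1 + ?k \<ge> 0" using R by (simp_all add: zero_le_mult_iff)
      qed
      have "(R * (1 + ?h)) powr (- 1 / 8) + (R * (1 + ?k)) powr (- 1 / 8) =
          R powr (- 1 / 8) * ((1 + ?h) powr (- 1 / 8) + (1 + ?k) powr (- 1 / 8))"
        unfolding distrib_left[of "R powr (- 1 / 8)"]
        by (intro arg_cong2[where f = "(+)"] powr_mult)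
      also have "\<dots> \<le> R powr (- 1 / 8) *
          ((1 - ?h / 8 + 11 / 128 * ?h\<^sup>2) + (1 - ?k / 8 + 11 / 128 * ?k\<^sup>2))"
        using \<delta>(2)[OF h(1)] \<delta>(2)[OF h(2)] by (intro mult_left_mono add_mono) auto
      also have "(1 - ?h / 8 + 11 / 128 * ?h\<^sup>2) + (1 - ?k / 8 + 11 / 128 * ?k\<^sup>2) =
          2 - 1 / (4 * R) + 11 / 64 / R\<^sup>2 * (4 * (?p i)\<^sup>2 + 1)"
        using R by (simp add: field_simps power2_eq_square)
      finally show ?thesis unfolding plus minus .
    qed
    have "(\<Sum>v\<in>unit_steps. ((norm (real_vec (x + v)))\<^sup>2 + C) powr (- 1 / 8)) \<le>
        (\<Sum>i\<in>UNIV. R powr (- 1 / 8) * (2 - 1 / (4 * R) + 11 / 64 / R\<^sup>2 * (4 * (?p i)\<^sup>2 + 1)))"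
      unfolding sum_unit_steps by (intro sum_mono pair)
    also have "\<dots> = R powr (- 1 / 8) *
        (2 * D - D / (4 * R) + 11 / 64 / R\<^sup>2 * (4 * (norm (real_vec x))\<^sup>2 + D))"
      unfolding sum_distrib_left[symmetric] sum.distrib sum_subtractf norm_sq_sum
      by (simp add: D_def algebra_simps)
    also have "\<dots> \<le> R powr (- 1 / 8) * (2 * D - D / (4 * R) + 11 / 64 / R\<^sup>2 * (4 * R + D))"
      using C R by (intro mult_left_mono add_left_mono) (auto simp: R_def)
    also have "\<dots> \<le> R powr (- 1 / 8) * (2 * D * (1 - gain R))"
    proof (rule mult_left_mono)
      have "2 * D * (1 - gain R) = 2 * D - (D / 48 / R - 11 * D / 64 / R\<^sup>2)"
        using D by (simp add: gain_def field_simps)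
      moreover have "11 / 64 / R\<^sup>2 * (4 * R + D) = 11 / 16 / R + 11 * D / 64 / R\<^sup>2"
        using R by (simp add: field_simps power2_eq_square)
      moreover have "D / 48 / R + 11 / 16 / R \<le> D / (4 * R)"
        using R D by (simp add: field_simps)
      ultimately show "2 * D - D / (4 * R) + 11 / 64 / R\<^sup>2 * (4 * R + D) \<le> 2 * D * (1 - gain R)"
        by linarith
    qed simp
    finally have "(\<Sum>v\<in>unit_steps. ((norm (real_vec (x + v)))\<^sup>2 + C) powr (- 1 / 8)) / (2 * D)
        \<le> R powr (- 1 / 8) * (2 * D * (1 - gain R)) / (2 * D)"
      using D by (intro divide_right_mono) auto
    also have "\<dots> = R powr (- 1 / 8) * (1 - gain R)"
      using D by simp
    finally have "(\<Sum>v\<in>unit_steps. ((norm (real_vec (x + v)))\<^sup>2 + C) powr (- 1 / 8)) / (2 * D)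
        \<le> R powr (- 1 / 8) * (1 - gain R)" .
    then show ?thesis by (simp add: sum_negf R_def)
  qed
  have "- (((norm (real_vec x))\<^sup>2 + C) powr (- 1 / 8)) + C powr (- 1 / 8) * gain C * of_bool (x \<in> {0}) \<le>
    (\<Sum>v\<in>unit_steps. - (((norm (real_vec (x + v)))\<^sup>2 + C) powr (- 1 / 8))) / (2 * real CARD('d))"
    for x :: "int ^ 'd"
  proof -
    have "gain ((norm (real_vec x))\<^sup>2 + C) > 0" by (rule gain) (use C in \<open>simp add: add_increasing\<close>)
    then have "- (((norm (real_vec x))\<^sup>2 + C) powr (- 1 / 8)) + C powr (- 1 / 8) * gain C * of_bool (x \<in> {0}) \<le>
        - (((norm (real_vec x))\<^sup>2 + C) powr (- 1 / 8)) * (1 - gain ((norm (real_vec x))\<^sup>2 + C))"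
      by (cases "x = 0") (auto simp: algebra_simps)
    with step[of x] show ?thesis unfolding D_def by linarith
  qed
  moreover have "C powr (- 1 / 8) * gain C > 0" using C gain[of C] by simp
  ultimately show ?thesis using C(2) by blast
qed

lemma origin_green_bounded:
  assumes d: "CARD('d) \<ge> 3"
  shows "\<exists>K. \<forall>n. (\<Sum>j<n. path_prob j (\<lambda>xs. sum_list xs \<in> {0 :: int ^ 'd})) \<le> K"
proof -
  obtain C c where C: "C \<ge> 1" and c: "c > 0" and sub: "\<And>x :: int ^ 'd.
    - (((norm (real_vec x))\<^sup>2 + C) powr (- 1 / 8)) + c * of_bool (x \<in> {0}) \<le>
    (\<Sum>v\<in>unit_steps. - (((norm (real_vec (x + v)))\<^sup>2 + C) powr (- 1 / 8))) / (2 * real CARD('d))"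
    using norm_sq_bounded_subharmonic[OF d] by blast
  have "(\<Sum>j<n. path_prob j (\<lambda>xs. sum_list xs \<in> {0 :: int ^ 'd})) \<le> C powr (- 1 / 8) / c" for n
  proof -
    have "- (((norm (real_vec (0 :: int ^ 'd)))\<^sup>2 + C) powr (- 1 / 8)) +
        c * (\<Sum>j<n. path_prob j (\<lambda>xs. sum_list xs \<in> {0 :: int ^ 'd})) \<le>
        path_mean n (\<lambda>xs :: (int ^ 'd) list. - (((norm (real_vec (sum_list xs)))\<^sup>2 + C) powr (- 1 / 8)))"
      by (rule drift_bound[OF sub])
    also have "\<dots> \<le> path_mean n (\<lambda>_ :: (int ^ 'd) list. 0)"
      by (rule path_mean_mono) simp
    finally show ?thesis
      using c by (simp add: field_simps)
  qed
  then show ?thesis by blast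
qed

lemma inner_real_vec: "real_vec a \<bullet> real_vec x = real_of_int (\<Sum>i\<in>UNIV. a $ i * x $ i)"
  by (simp add: inner_vec_def real_vec_def)

text \<open>Gram-Schmidt over the reals. Orthonormality makes the covariance of the projected walk a multiple of
  the identity, so that the logarithm of the norm is nearly harmonic.\<close>

lemma orthonormal_pair_vanishing_on_lattice_subspace:
  fixes a b :: "int ^ 'd"
  assumes "a \<noteq> 0" "\<not> parallel_vec a b"
  shows "\<exists>\<alpha> \<beta> :: real ^ 'd. norm \<alpha> = 1 \<and> norm \<beta> = 1 \<and> \<alpha> \<bullet> \<beta> = 0 \<and>
    (\<forall>x \<in> lattice_subspace a b. \<alpha> \<bullet> real_vec x = 0 \<and> \<beta> \<bullet> real_vec x = 0)"
proof -
  define u where "u = real_vec a"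
  define c where "c = (real_vec b \<bullet> u) / (u \<bullet> u)"
  define v where "v = real_vec b - c *\<^sub>R u"
  have u: "u \<noteq> 0" using \<open>a \<noteq> 0\<close> by (auto simp: u_def real_vec_def vec_eq_iff)
  have v: "v \<noteq> 0"
  proof
    assume "v = 0"
    then have "\<forall>i. real_of_int (b $ i) = c * real_of_int (a $ i)"
      by (simp add: v_def u_def real_vec_def vec_eq_iff)
    with assms(2) show False unfolding parallel_vec_def by blast
  qed
  have uv: "u \<bullet> v = 0"
    using u by (simp add: v_def c_def inner_diff_right inner_commute)
  have "u \<bullet> real_vec x = 0 \<and> v \<bullet> real_vec x = 0" if "x \<in> lattice_subspace a b" for x
    using that by (simp add: u_def v_def inner_diff_left inner_real_vec lattice_subspace_def)
  then show ?thesis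
    using u v uv by (intro exI[of _ "u /\<^sub>R norm u"] exI[of _ "v /\<^sub>R norm v"]) simp
qed

text \<open>Adding the quartic Taylor polynomials of the logarithm for two opposite steps: the odd powers of \<open>p\<close>
  cancel, the cubic terms have the right sign, and everything beyond the two leading terms is of
  order \<open>1 / R\<^sup>2\<close>.\<close>

lemma quartic_pair_ge:
  fixes R p s :: real
  assumes "R \<ge> 1" "0 \<le> s" "s \<le> 2" "p\<^sup>2 \<le> 2 * R"
  defines "h \<equiv> (2 * p + s) / R" and "k \<equiv> (s - 2 * p) / R"
  shows "2 * s / R - 4 * p\<^sup>2 / R\<^sup>2 - 300 / R\<^sup>2 \<le>
    (h - h\<^sup>2 / 2 + h ^ 3 / 3 - h ^ 4 / 2) + (k - k\<^sup>2 / 2 + k ^ 3 / 3 - k ^ 4 / 2)"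
proof -
  have R: "R > 0" using assms by simp
  have hk1: "h + k = 2 * s / R"
    by (simp add: h_def k_def add_divide_distrib[symmetric])
  have hk2: "h\<^sup>2 + k\<^sup>2 \<le> 8 * (p\<^sup>2 / R\<^sup>2) + 8 * (1 / R\<^sup>2)"
  proof -
    have "h\<^sup>2 + k\<^sup>2 = (8 * p\<^sup>2 + 2 * s\<^sup>2) / R\<^sup>2"
      unfolding h_def k_def power_divide add_divide_distrib[symmetric]
      by (simp add: power2_eq_square algebra_simps)
    also have "s\<^sup>2 \<le> 2\<^sup>2" using assms by (intro power_mono) auto
    then have "(8 * p\<^sup>2 + 2 * s\<^sup>2) / R\<^sup>2 \<le> (8 * p\<^sup>2 + 8) / R\<^sup>2"
      by (intro divide_right_mono) auto
    finally show ?thesis by (simp add: add_divide_distrib)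
  qed
  have hk3: "0 \<le> h ^ 3 + k ^ 3"
  proof -
    have "h ^ 3 + k ^ 3 = (2 * s ^ 3 + 24 * p\<^sup>2 * s) / R ^ 3"
      unfolding h_def k_def power_divide add_divide_distrib[symmetric]
      by (simp add: power2_eq_square power3_eq_cube algebra_simps)
    with assms R show ?thesis by simp
  qed
  have hk4: "h ^ 4 + k ^ 4 \<le> 544 * (1 / R\<^sup>2)"
  proof -
    have s2: "s\<^sup>2 \<le> 2\<^sup>2" using assms by (intro power_mono) auto
    have RR: "R \<le> R\<^sup>2" "1 \<le> R\<^sup>2" using assms by (auto simp: power2_eq_square intro: order_trans[of 1 R])
    have "(p\<^sup>2)\<^sup>2 \<le> (2 * R)\<^sup>2" using assms by (intro power_mono) auto
    moreover have "p\<^sup>2 * s\<^sup>2 \<le> (2 * R) * 4" using s2 assms by (intro mult_mono) auto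
    moreover have "(s\<^sup>2)\<^sup>2 \<le> 4\<^sup>2" using s2 by (intro power_mono) auto
    ultimately have le: "2 * (16 * (p\<^sup>2)\<^sup>2 + 24 * p\<^sup>2 * s\<^sup>2 + (s\<^sup>2)\<^sup>2) \<le> 544 * R\<^sup>2"
      using RR by (simp add: power_mult_distrib)
    have "h ^ 4 + k ^ 4 = 2 * (16 * (p\<^sup>2)\<^sup>2 + 24 * p\<^sup>2 * s\<^sup>2 + (s\<^sup>2)\<^sup>2) / R ^ 4"
      unfolding h_def k_def power_divide add_divide_distrib[symmetric]
      by (simp add: power2_eq_square power4_eq_xxxx algebra_simps)
    also have "\<dots> \<le> 544 * R\<^sup>2 / R ^ 4"
      using R le by (intro divide_right_mono) auto
    also have "\<dots> = 544 * (1 / R\<^sup>2)" using R by (simp add: power2_eq_square power4_eq_xxxx)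
    finally show ?thesis .
  qed
  have "300 / R\<^sup>2 = 300 * (1 / R\<^sup>2)" "4 * p\<^sup>2 / R\<^sup>2 = 4 * (p\<^sup>2 / R\<^sup>2)" "0 \<le> 1 / R\<^sup>2" by simp_all
  with hk1 hk2 hk3 hk4 show ?thesis by linarith
qed

text \<open>Let \<open>R = Q x + C\<close>. Summing \<open>quartic_pair_ge\<close> over the coordinates gives
  \<open>4 / R - 4 * Q x / R\<^sup>2 = 4 * C / R\<^sup>2\<close> for the leading terms, which absorbs the error terms of order
  \<open>1 / R\<^sup>2\<close> if \<open>C\<close> is large. In the plane \<open>ln\<close> of the squared norm is harmonic, so it is the
  constant \<open>C\<close> alone that provides the positive drift.\<close>

lemma log_norm_sq_subharmonic:
  fixes \<alpha> \<beta> :: "real ^ 'd"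
  assumes unit: "norm \<alpha> = 1" "norm \<beta> = 1" and orth: "\<alpha> \<bullet> \<beta> = 0"
  defines "Q \<equiv> \<lambda>x :: int ^ 'd. (\<alpha> \<bullet> real_vec x)\<^sup>2 + (\<beta> \<bullet> real_vec x)\<^sup>2"
  shows "\<exists>C c. C \<ge> 1 \<and> c > 0 \<and> (\<forall>x. ln (Q x + C) + c * of_bool (Q x = 0) \<le>
    (\<Sum>v\<in>unit_steps. ln (Q (x + v) + C)) / (2 * real CARD('d)))"
proof -
  obtain \<delta> :: real where \<delta>: "\<delta> > 0"
    "\<And>h. \<bar>h\<bar> < \<delta> \<Longrightarrow> h - h\<^sup>2 / 2 + h ^ 3 / 3 - h ^ 4 / 2 \<le> ln (1 + h)"
    using ln_ge_quartic by blast
  define D where "D = real CARD('d)"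
  have D: "D > 0" by (simp add: D_def)
  \<comment> \<open>\<open>4 * C\<close> exceeds the total error \<open>300 * D\<close>; the other bounds keep
    the relative increments below \<open>\<delta>\<close> and 1\<close>
  define C where "C = max (75 * D + 1) (max 1 (max ((5 / \<delta>)\<^sup>2) ((5 / 1)\<^sup>2)))"
  have C: "C \<ge> 75 * D + 1" "C \<ge> 1" "C \<ge> (5 / \<delta>)\<^sup>2" "C \<ge> (5 / 1)\<^sup>2" by (auto simp: C_def)
  have step: "2 * D * ln (Q x + C) + 4 / (Q x + C)\<^sup>2 \<le> (\<Sum>v\<in>unit_steps. ln (Q (x + v) + C))" for x
  proof -
    define R where "R = Q x + C"
    have Q: "Q x \<ge> 0" by (simp add: Q_def)
    have R: "R \<ge> 1" "R \<ge> (5 / \<delta>)\<^sup>2" "R \<ge> (5 / 1)\<^sup>2" using C Q by (auto simp: R_def)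
    define u where "u = \<alpha> \<bullet> real_vec x"
    define v where "v = \<beta> \<bullet> real_vec x"
    define p where "p i = \<alpha> $ i * u + \<beta> $ i * v" for i
    define s where "s i = (\<alpha> $ i)\<^sup>2 + (\<beta> $ i)\<^sup>2" for i
    have sum_s: "(\<Sum>i\<in>UNIV. s i) = 2"
      using unit norm_sq_sum[of \<alpha>] norm_sq_sum[of \<beta>] by (simp add: s_def sum.distrib)
    have sum_p: "(\<Sum>i\<in>UNIV. (p i)\<^sup>2) = Q x"
    proof -
      have "(\<Sum>i\<in>UNIV. (p i)\<^sup>2) = (norm (u *\<^sub>R \<alpha> + v *\<^sub>R \<beta>))\<^sup>2"
        unfolding norm_sq_sum by (simp add: p_def mult.commute)
      also have "\<dots> = u\<^sup>2 + v\<^sup>2"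
        using unit orth unfolding power2_norm_eq_inner
        by (simp add: inner_add inner_commute[of \<beta> \<alpha>] norm_eq_1 power2_eq_square)
      finally show ?thesis by (simp add: Q_def u_def v_def)
    qed
    have s: "0 \<le> s i" "s i \<le> 2" for i
    proof -
      show "0 \<le> s i" by (simp add: s_def)
      have "s i \<le> (\<Sum>i\<in>UNIV. s i)" by (rule member_le_sum) (auto simp: s_def)
      then show "s i \<le> 2" by (simp add: sum_s)
    qed
    have p: "(p i)\<^sup>2 \<le> R" for i
    proof -
      have "(p i)\<^sup>2 \<le> (\<Sum>i\<in>UNIV. (p i)\<^sup>2)" by (rule member_le_sum) auto
      then show ?thesis using C by (simp add: sum_p R_def)
    qed
    have e: "R * (1 + y / R) = R + y" for y using R by (simp add: field_simps)
    have plus: "Q (x + axis i 1) + C = R * (1 + (2 * p i + s i) / R)"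
      and minus: "Q (x + - axis i 1) + C = R * (1 + (s i - 2 * p i) / R)" for i
      unfolding e unfolding Q_def real_vec_add real_vec_axis R_def p_def s_def u_def v_def
      by (simp_all add: inner_add_right inner_axis power2_eq_square algebra_simps)
    have pair: "2 * ln R + (2 * s i / R - 4 * (p i)\<^sup>2 / R\<^sup>2 - 300 / R\<^sup>2) \<le>
        ln (Q (x + axis i 1) + C) + ln (Q (x + - axis i 1) + C)" for i
    proof -
      let ?h = "(2 * p i + s i) / R" and ?k = "(s i - 2 * p i) / R"
      have h: "\<bar>?h\<bar> < \<delta>" "\<bar>?k\<bar> < \<delta>"
        by (rule increment_over_norm_small[OF \<delta>(1) R(1,2) p s])+
      have "\<bar>?h\<bar> < 1" "\<bar>?k\<bar> < 1"
        by (rule increment_over_norm_small[OF zero_less_one R(1,3) p s])+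
      then have pos: "0 < 1 + ?h" "0 < 1 + ?k" by linarith+
      have "2 * s i / R - 4 * (p i)\<^sup>2 / R\<^sup>2 - 300 / R\<^sup>2 \<le> ln (1 + ?h) + ln (1 + ?k)"
        using quartic_pair_ge[OF R(1) s, of "p i" i] p[of i] R(1) \<delta>(2)[OF h(1)] \<delta>(2)[OF h(2)]
        by linarith
      moreover have "ln (R * (1 + ?h)) = ln R + ln (1 + ?h)"
        "ln (R * (1 + ?k)) = ln R + ln (1 + ?k)"
        using R pos by (intro ln_mult_pos; simp)+
      ultimately show ?thesis unfolding plus minus by linarith
    qed
    have "2 * D * ln R + 4 / R\<^sup>2 \<le> 2 * D * ln R + (2 * 2 / R - 4 * Q x / R\<^sup>2 - 300 * D / R\<^sup>2)"
    proof -
      have "2 * 2 / R = 4 * R / R\<^sup>2" using R by (simp add: power2_eq_square)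
      also have "\<dots> = 4 * Q x / R\<^sup>2 + 4 * C / R\<^sup>2" by (simp add: R_def add_divide_distrib distrib_left)
      finally have "2 * 2 / R - 4 * Q x / R\<^sup>2 - 300 * D / R\<^sup>2 = (4 * C - 300 * D) / R\<^sup>2"
        by (simp add: diff_divide_distrib)
      moreover have "4 / R\<^sup>2 \<le> (4 * C - 300 * D) / R\<^sup>2"
        using C by (intro divide_right_mono) auto
      ultimately show ?thesis by linarith
    qed
    also have "\<dots> = (\<Sum>i\<in>UNIV. 2 * ln R + (2 * s i / R - 4 * (p i)\<^sup>2 / R\<^sup>2 - 300 / R\<^sup>2))"
      by (simp add: sum.distrib sum_subtractf sum_divide_distrib[symmetric] sum_distrib_left[symmetric]
          sum_s sum_p D_def)
    also have "\<dots> \<le> (\<Sum>v\<in>unit_steps. ln (Q (x + v) + C))"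
      unfolding sum_unit_steps by (intro sum_mono pair)
    finally show ?thesis unfolding R_def .
  qed
  have "ln (Q x + C) + 2 / (D * C\<^sup>2) * of_bool (Q x = 0) \<le>
      (\<Sum>v\<in>unit_steps. ln (Q (x + v) + C)) / (2 * real CARD('d))" for x
  proof -
    have "2 / (D * C\<^sup>2) * of_bool (Q x = 0) \<le> (4 / (Q x + C)\<^sup>2) / (2 * D)"
      using D C by (auto simp: mult.commute)
    then have "ln (Q x + C) + 2 / (D * C\<^sup>2) * of_bool (Q x = 0) \<le>
        (2 * D * ln (Q x + C) + 4 / (Q x + C)\<^sup>2) / (2 * D)"
      using D by (simp add: add_divide_distrib)
    also have "\<dots> \<le> (\<Sum>v\<in>unit_steps. ln (Q (x + v) + C)) / (2 * D)"
      using step[of x] D by (intro divide_right_mono) auto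
    finally show ?thesis by (simp add: D_def)
  qed
  moreover have "2 / (D * C\<^sup>2) > 0" using D C by simp
  ultimately show ?thesis using C(2) by blast
qed

lemma lattice_subspace_green_le_log:
  fixes a b :: "int ^ 'd"
  assumes "a \<noteq> 0" "\<not> parallel_vec a b"
  shows "\<exists>K>0. \<forall>n\<ge>2. (\<Sum>j\<le>n. path_prob j (\<lambda>xs. sum_list xs \<in> lattice_subspace a b)) \<le> K * ln (real n)"
proof -
  obtain \<alpha> \<beta> :: "real ^ 'd" where ab: "norm \<alpha> = 1" "norm \<beta> = 1" "\<alpha> \<bullet> \<beta> = 0"
    "\<And>x. x \<in> lattice_subspace a b \<Longrightarrow> \<alpha> \<bullet> real_vec x = 0 \<and> \<beta> \<bullet> real_vec x = 0"
    using orthonormal_pair_vanishing_on_lattice_subspace[OF assms] by blast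
  define Q where "Q x = (\<alpha> \<bullet> real_vec x)\<^sup>2 + (\<beta> \<bullet> real_vec x)\<^sup>2" for x :: "int ^ 'd"
  obtain C c where C: "C \<ge> 1" and c: "c > 0" and
    sub: "\<And>x. ln (Q x + C) + c * of_bool (Q x = 0) \<le>
      (\<Sum>v\<in>unit_steps. ln (Q (x + v) + C)) / (2 * real CARD('d))"
    using log_norm_sq_subharmonic[OF ab(1-3)] unfolding Q_def by blast
  have sub': "ln (Q x + C) + c * of_bool (x \<in> lattice_subspace a b) \<le>
      (\<Sum>v\<in>unit_steps. ln (Q (x + v) + C)) / (2 * real CARD('d))" for x
    using sub[of x] ab(4)[of x] c by (auto simp: Q_def of_bool_def split: if_splits)
  define K where "K = (ln (8 + C) / ln 2 + 2) / c"
  have K: "K > 0" using c C by (simp add: K_def add_pos_pos)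
  have "(\<Sum>j\<le>n. path_prob j (\<lambda>xs. sum_list xs \<in> lattice_subspace a b)) \<le> K * ln (real n)"
    if n: "n \<ge> 2" for n
  proof -
    let ?G = "\<Sum>j\<le>n. path_prob j (\<lambda>xs. sum_list xs \<in> lattice_subspace a b)"
    have "c * ?G \<le> ln (Q 0 + C) + c * ?G" using C by (simp add: Q_def)
    also have "\<dots> \<le> path_mean (Suc n) (\<lambda>xs. ln (Q (sum_list xs) + C))"
      using drift_bound[where \<phi> = "\<lambda>x. ln (Q x + C)", OF sub', of "Suc n"]
      by (simp add: lessThan_Suc_atMost)
    also have "\<dots> \<le> path_mean (Suc n) (\<lambda>_ :: (int ^ 'd) list. ln ((8 + C) * real n ^ 2))"
    proof (rule path_mean_mono)
      fix xs :: "(int ^ 'd) list" assume xs: "length xs = Suc n" "set xs \<subseteq> unit_steps"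
      have nm: "norm (real_vec (sum_list xs)) \<le> 2 * real n"
        using norm_sum_unit_steps_le[OF xs(2)] xs(1) n by simp
      have sq: "(\<gamma> \<bullet> real_vec (sum_list xs))\<^sup>2 \<le> 4 * (real n)\<^sup>2" if "norm \<gamma> = 1" for \<gamma>
      proof -
        have "\<bar>\<gamma> \<bullet> real_vec (sum_list xs)\<bar> \<le> 2 * real n"
          using Cauchy_Schwarz_ineq2[of \<gamma> "real_vec (sum_list xs)"] nm that by simp
        then have "(\<gamma> \<bullet> real_vec (sum_list xs))\<^sup>2 \<le> (2 * real n)\<^sup>2"
          by (metis abs_ge_zero power2_abs power_mono)
        then show ?thesis by (simp add: power_mult_distrib)
      qed
      have "C * 1 \<le> C * (real n)\<^sup>2" using n C by (intro mult_left_mono) auto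
      then have "Q (sum_list xs) + C \<le> (8 + C) * (real n)\<^sup>2"
        using sq[OF ab(1)] sq[OF ab(2)] unfolding Q_def by (simp add: algebra_simps)
      moreover have "Q (sum_list xs) + C > 0" using C by (simp add: Q_def add_nonneg_pos)
      ultimately show "ln (Q (sum_list xs) + C) \<le> ln ((8 + C) * (real n)\<^sup>2)" by simp
    qed
    also have "\<dots> = ln (8 + C) + 2 * ln (real n)"
      using n C by (simp add: ln_mult_pos ln_realpow)
    also have "ln (8 + C) \<le> ln (8 + C) / ln 2 * ln (real n)"
    proof -
      have "ln (8 + C) / ln 2 * ln 2 \<le> ln (8 + C) / ln 2 * ln (real n)"
        using n C by (intro mult_left_mono) auto
      then show ?thesis by simp
    qed
    finally have "c * ?G \<le> (ln (8 + C) / ln 2 + 2) * ln (real n)" by (simp add: algebra_simps)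
    then show ?thesis using c by (simp add: K_def field_simps)
  qed
  with K show ?thesis by blast
qed

section \<open>The logarithmic lower bound, by the second moment\<close>

definition int_dot :: "int ^ 'd \<Rightarrow> int ^ 'd \<Rightarrow> int"
  where "int_dot a x = (\<Sum>i\<in>UNIV. a $ i * x $ i)"

lemma int_dot_add: "int_dot a (x + y) = int_dot a x + int_dot a y"
  by (simp add: int_dot_def distrib_left sum.distrib)

lemma int_dot_minus: "int_dot a (- x) = - int_dot a x"
  by (simp add: int_dot_def sum_negf)

lemma int_dot_diff: "int_dot a (x - y) = int_dot a x - int_dot a y"
  using int_dot_add[of a x "- y"] by (simp add: int_dot_minus)

lemma int_dot_zero [simp]: "int_dot a 0 = 0"
  by (simp add: int_dot_def)

lemma int_dot_axis: "int_dot a (axis i 1) = a $ i"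
  by (simp add: int_dot_def axis_def if_distrib cong: if_cong)

lemma lattice_subspace_iff: "x \<in> lattice_subspace a b \<longleftrightarrow> (int_dot a x, int_dot b x) = (0, 0)"
  by (simp add: lattice_subspace_def int_dot_def)

lemma sum_list_map_uminus: "sum_list (map uminus xs) = - sum_list (xs :: 'a::ab_group_add list)"
  by (induction xs) auto

lemma second_moment_int_dot:
  fixes a :: "int ^ 'd"
  shows "path_mean n (\<lambda>xs. (real_of_int (int_dot a (sum_list xs)))\<^sup>2) =
    real n * ((\<Sum>i\<in>UNIV. (real_of_int (a $ i))\<^sup>2) / real CARD('d))"
proof (induction n)
  case (Suc n)
  let ?f = "\<lambda>xs. real_of_int (int_dot a (sum_list xs))"
  have "path_mean n (\<lambda>xs. (?f (axis i 1 # xs))\<^sup>2) + path_mean n (\<lambda>xs. (?f (- axis i 1 # xs))\<^sup>2) =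
      2 * (real_of_int (a $ i))\<^sup>2 + 2 * path_mean n (\<lambda>xs. (?f xs)\<^sup>2)" for i
  proof -
    have "path_mean n (\<lambda>xs. (?f (axis i 1 # xs))\<^sup>2) + path_mean n (\<lambda>xs. (?f (- axis i 1 # xs))\<^sup>2) =
        path_mean n (\<lambda>xs. 2 * (real_of_int (a $ i))\<^sup>2 + 2 * (?f xs)\<^sup>2)"
      unfolding path_mean_add[symmetric]
      by (rule path_mean_cong)
        (simp add: int_dot_add int_dot_diff int_dot_axis power2_eq_square algebra_simps)
    then show ?thesis by (simp only: path_mean_add path_mean_cmult path_mean_const)
  qed
  then have "path_mean (Suc n) (\<lambda>xs. (?f xs)\<^sup>2) =
      (\<Sum>i\<in>UNIV. 2 * (real_of_int (a $ i))\<^sup>2 + 2 * path_mean n (\<lambda>xs. (?f xs)\<^sup>2)) / (2 * real CARD('d))"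
    unfolding path_mean.simps sum_unit_steps by simp
  also have "\<dots> = (\<Sum>i\<in>UNIV. (real_of_int (a $ i))\<^sup>2) / real CARD('d) + path_mean n (\<lambda>xs. (?f xs)\<^sup>2)"
    by (simp add: sum.distrib sum_distrib_left[symmetric] add_divide_distrib)
  finally show ?case unfolding Suc by (simp add: distrib_right add_divide_distrib)
qed simp

lemma chebyshev_int_dot:
  fixes a :: "int ^ 'd"
  assumes "R > 0"
  shows "path_prob n (\<lambda>xs. int_dot a (sum_list xs) \<notin> {- int R..int R}) \<le>
    real n * (\<Sum>i\<in>UNIV. (real_of_int (a $ i))\<^sup>2) / (real R)\<^sup>2"
proof -
  let ?K = "\<Sum>i\<in>UNIV. (real_of_int (a $ i))\<^sup>2"
  have "path_prob n (\<lambda>xs. int_dot a (sum_list xs) \<notin> {- int R..int R}) \<le>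
      path_mean n (\<lambda>xs. (1 / (real R)\<^sup>2) * (real_of_int (int_dot a (sum_list xs)))\<^sup>2)"
  proof (rule path_mean_mono)
    fix xs :: "(int ^ 'd) list"
    show "of_bool (int_dot a (sum_list xs) \<notin> {- int R..int R}) \<le>
      (1 / (real R)\<^sup>2) * (real_of_int (int_dot a (sum_list xs)))\<^sup>2"
    proof (cases "int_dot a (sum_list xs) \<in> {- int R..int R}")
      case False
      then have "int R \<le> \<bar>int_dot a (sum_list xs)\<bar>" by auto
      then have "real R \<le> \<bar>real_of_int (int_dot a (sum_list xs))\<bar>" by linarith
      then have "(real R)\<^sup>2 \<le> (real_of_int (int_dot a (sum_list xs)))\<^sup>2"
        by (metis of_nat_0_le_iff power2_abs power_mono)
      with False assms show ?thesis by (simp add: field_simps)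
    qed simp
  qed
  also have "\<dots> = (real n * (?K / real CARD('d))) / (real R)\<^sup>2"
    unfolding path_mean_cmult second_moment_int_dot by simp
  also have "\<dots> \<le> (real n * ?K) / (real R)\<^sup>2"
  proof (intro divide_right_mono mult_left_mono)
    have "?K * 1 \<le> ?K * real CARD('d)" by (intro mult_left_mono sum_nonneg) auto
    then show "?K / real CARD('d) \<le> ?K" by (simp add: divide_le_eq)
  qed auto
  finally show ?thesis by simp
qed

text \<open>A walk of length \<open>2 * n\<close> is a difference of two independent walks of length \<open>n\<close> by the symmetry of
  the steps, and \<open>T\<close> takes the value \<open>z\<close> on it iff \<open>T\<close> agrees on the two.\<close>

lemma even_time_return_ge_sum_squares:
  fixes T :: "int ^ 'd \<Rightarrow> 'b"
  assumes T: "\<And>x y. T (x - y) = z \<longleftrightarrow> T x = T y" and "finite B"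
  shows "(\<Sum>y\<in>B. (path_prob n (\<lambda>xs. T (sum_list xs) = y))\<^sup>2) \<le>
    path_prob (2 * n) (\<lambda>xs. T (sum_list xs) = z)"
proof -
  let ?q = "\<lambda>y. path_prob n (\<lambda>xs. T (sum_list xs) = y)"
  have "(\<Sum>y\<in>B. (?q y)\<^sup>2) = (\<Sum>y\<in>B. path_mean n (\<lambda>xs. of_bool (T (sum_list xs) = y) * ?q y))"
    unfolding path_mean_multc by (simp add: power2_eq_square)
  also have "\<dots> = path_mean n (\<lambda>xs. \<Sum>y\<in>B. of_bool (T (sum_list xs) = y) * ?q y)"
    unfolding path_mean_sum ..
  also have "\<dots> \<le> path_mean n (\<lambda>xs. ?q (T (sum_list xs)))"
  proof (rule path_mean_mono)
    fix xs :: "(int ^ 'd) list"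
    have "(\<Sum>y\<in>B. of_bool (T (sum_list xs) = y) * ?q y) =
        (\<Sum>y\<in>B. if y = T (sum_list xs) then ?q y else 0)"
      by (intro sum.cong) auto
    also have "\<dots> \<le> ?q (T (sum_list xs))"
      using \<open>finite B\<close> by (simp add: sum.delta path_prob_nonneg)
    finally show "(\<Sum>y\<in>B. of_bool (T (sum_list xs) = y) * ?q y) \<le> ?q (T (sum_list xs))" .
  qed
  also have "\<dots> = path_mean n (\<lambda>xs. path_prob n (\<lambda>ys. T (sum_list (xs @ ys)) = z))"
  proof (rule path_mean_cong)
    fix xs :: "(int ^ 'd) list"
    have "path_prob n (\<lambda>ys. T (sum_list (xs @ ys)) = z) =
        path_prob n (\<lambda>ys. T (sum_list (xs @ map uminus ys)) = z)"
      by (rule path_mean_uminus[where f = "\<lambda>ys. of_bool (T (sum_list (xs @ ys)) = z)", symmetric])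
    then show "?q (T (sum_list xs)) = path_prob n (\<lambda>ys. T (sum_list (xs @ ys)) = z)"
      using T by (simp add: sum_list_map_uminus eq_commute[of "T (sum_list xs)"])
  qed
  also have "\<dots> = path_prob (2 * n) (\<lambda>xs. T (sum_list xs) = z)"
    unfolding mult_2 path_mean_append ..
  finally show ?thesis .
qed

text \<open>By Chebyshev's inequality the pair of inner products at time \<open>n\<close> lies, with probability at least
  \<open>1 / 2\<close>, in a set of at most \<open>50 * n * K\<close> values; by the Cauchy-Schwarz inequality two independent
  copies then agree with probability at least \<open>1 / (200 * n * K)\<close>.\<close>

lemma lattice_subspace_even_time_ge:
  fixes a b :: "int ^ 'd"
  shows "\<exists>c>0. \<forall>n\<ge>1. c / real n \<le> path_prob (2 * n) (\<lambda>xs. sum_list xs \<in> lattice_subspace a b)"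
proof -
  define Ka where "Ka = (\<Sum>i\<in>UNIV. (real_of_int (a $ i))\<^sup>2)"
  define Kb where "Kb = (\<Sum>i\<in>UNIV. (real_of_int (b $ i))\<^sup>2)"
  define K where "K = Ka + Kb + 1"
  have K: "Ka \<ge> 0" "Kb \<ge> 0" "K \<ge> 1" by (auto simp: K_def Ka_def Kb_def sum_nonneg)
  let ?T = "\<lambda>x. (int_dot a x, int_dot b x)"
  have "1 / (200 * K) / real n \<le> path_prob (2 * n) (\<lambda>xs. sum_list xs \<in> lattice_subspace a b)"
    if n: "n \<ge> 1" for n
  proof -
    define s where "s = sqrt (2 * real n * K)"
    have "1 * 1 \<le> 2 * real n * K" using n K by (intro mult_mono) auto
    moreover from this have "0 \<le> 2 * real n * K" by linarith
    ultimately have s: "s \<ge> 1" "s\<^sup>2 = 2 * real n * K" unfolding s_def by simp_all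
    \<comment> \<open>large enough that, by Chebyshev's inequality, the probability that one of the inner
      products exceeds it in absolute value is at most \<open>1 / 2\<close>\<close>
    define R where "R = nat \<lceil>s\<rceil>"
    have R: "s \<le> real R" "real R \<le> s + 1" using s(1) by (auto simp: R_def)
    then have R0: "R > 0" using s(1) by (cases R) auto
    have "s\<^sup>2 \<le> (real R)\<^sup>2" using R s(1) by (intro power_mono) auto
    then have RK: "2 * real n * K \<le> (real R)\<^sup>2" by (simp add: s(2))
    define B where "B = {- int R..int R} \<times> {- int R..int R}"
    have B: "finite B" "real (card B) \<le> 50 * (real n * K)"
    proof -
      show "finite B" by (simp add: B_def)
      have "real (card B) = (2 * real R + 1)\<^sup>2"
        by (simp add: B_def card_cartesian_product power2_eq_square)
      also have "\<dots> \<le> (5 * s)\<^sup>2" using R s(1) by (intro power_mono) auto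
      finally show "real (card B) \<le> 50 * (real n * K)" by (simp add: power_mult_distrib s(2))
    qed
    let ?q = "\<lambda>y. path_prob n (\<lambda>xs. ?T (sum_list xs) = y)"
    have "1 - (real n * Ka / (real R)\<^sup>2 + real n * Kb / (real R)\<^sup>2) \<le>
        1 - (path_prob n (\<lambda>xs. int_dot a (sum_list xs) \<notin> {- int R..int R}) +
             path_prob n (\<lambda>xs. int_dot b (sum_list xs) \<notin> {- int R..int R}))"
      unfolding Ka_def Kb_def by (intro diff_left_mono add_mono chebyshev_int_dot R0)
    also have "\<dots> = path_mean n (\<lambda>xs. 1 - (of_bool (int_dot a (sum_list xs) \<notin> {- int R..int R}) +
        of_bool (int_dot b (sum_list xs) \<notin> {- int R..int R})))"
      unfolding path_mean_diff path_mean_add path_mean_const ..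
    also have "\<dots> \<le> path_mean n (\<lambda>xs. \<Sum>y\<in>B. of_bool (?T (sum_list xs) = y))"
    proof (rule path_mean_mono)
      fix xs :: "(int ^ 'd) list"
      have "(\<Sum>y\<in>B. of_bool (?T (sum_list xs) = y)) = (\<Sum>y\<in>B. if y = ?T (sum_list xs) then 1 else (0::real))"
        by (intro sum.cong) auto
      also have "\<dots> = (if ?T (sum_list xs) \<in> B then 1 else 0)"
        using B(1) by (rule sum.delta)
      finally show "1 - (of_bool (int_dot a (sum_list xs) \<notin> {- int R..int R}) +
          of_bool (int_dot b (sum_list xs) \<notin> {- int R..int R})) \<le>
          (\<Sum>y\<in>B. of_bool (?T (sum_list xs) = y) :: real)"
        by (auto simp: B_def)
    qed
    also have "\<dots> = (\<Sum>y\<in>B. ?q y)" unfolding path_mean_sum ..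
    finally have mass: "1 - (real n * Ka / (real R)\<^sup>2 + real n * Kb / (real R)\<^sup>2) \<le> (\<Sum>y\<in>B. ?q y)" .
    have "real n * Ka / (real R)\<^sup>2 + real n * Kb / (real R)\<^sup>2 \<le> 1 / 2"
    proof -
      have "real n * Ka + real n * Kb \<le> real n * K" by (simp add: K_def algebra_simps)
      also have "\<dots> \<le> (real R)\<^sup>2 / 2" using RK by simp
      finally show ?thesis using R0 by (simp add: add_divide_distrib[symmetric] divide_le_eq)
    qed
    with mass have half: "1 / 2 \<le> (\<Sum>y\<in>B. ?q y)" by linarith
    have "(1 / 2)\<^sup>2 \<le> (\<Sum>y\<in>B. ?q y)\<^sup>2" using half by (intro power_mono) auto
    also have "\<dots> \<le> (\<Sum>y\<in>B. (?q y)\<^sup>2) * real (card B)"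
      by (rule sum_squared_le_sum_of_squares)
    also have "\<dots> \<le> path_prob (2 * n) (\<lambda>xs. ?T (sum_list xs) = (0, 0)) * (50 * (real n * K))"
    proof (intro mult_mono B path_prob_nonneg)
      have sub: "?T (x - y) = (0, 0) \<longleftrightarrow> ?T x = ?T y" for x y
        by (auto simp: int_dot_diff)
      show "(\<Sum>y\<in>B. (?q y)\<^sup>2) \<le> path_prob (2 * n) (\<lambda>xs. ?T (sum_list xs) = (0, 0))"
        by (rule even_time_return_ge_sum_squares[where T = ?T, OF sub B(1)])
    qed simp
    finally show ?thesis
      using n K unfolding lattice_subspace_iff by (simp add: field_simps power2_eq_square)
  qed
  moreover have "1 / (200 * K) > 0" using K by simp
  ultimately show ?thesis by blast
qed

lemma lattice_subspace_green_ge_log: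
  fixes a b :: "int ^ 'd"
  shows "\<exists>c>0. \<forall>n\<ge>4. c * ln (real n) \<le> (\<Sum>j\<le>n. path_prob j (\<lambda>xs. sum_list xs \<in> lattice_subspace a b))"
proof -
  obtain c where c: "c > 0" "\<And>n. n \<ge> 1 \<Longrightarrow>
    c / real n \<le> path_prob (2 * n) (\<lambda>xs. sum_list xs \<in> lattice_subspace a b)"
    using lattice_subspace_even_time_ge[of a b] by blast
  let ?g = "\<lambda>j. path_prob j (\<lambda>xs. sum_list xs \<in> lattice_subspace a b)"
  have "c / 2 * ln (real n) \<le> (\<Sum>j\<le>n. ?g j)" if n: "n \<ge> 4" for n
  proof -
    let ?m = "n div 2"
    have sq: "sqrt (real n) \<le> real n / 2"
    proof (rule real_le_lsqrt)
      have "4 * real n \<le> real n * real n" using n by (intro mult_right_mono) auto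
      then show "real n \<le> (real n / 2)\<^sup>2" by (simp add: power2_eq_square)
    qed simp
    have "ln (real n) / 2 = ln (sqrt (real n))" using n by (simp add: ln_sqrt)
    also have "\<dots> \<le> ln (real ?m + 1)"
    proof -
      have "real n / 2 \<le> real ?m + 1" by linarith
      then show ?thesis using sq n by (subst ln_le_cancel_iff) auto
    qed
    also have "\<dots> \<le> harm ?m" by (rule ln_le_harm)
    finally have "c * (ln (real n) / 2) \<le> c * harm ?m" using c(1) by (intro mult_left_mono) auto
    also have "\<dots> = (\<Sum>k=1..?m. c / real k)"
      by (simp add: harm_def sum_distrib_left divide_inverse)
    also have "\<dots> \<le> (\<Sum>k=1..?m. ?g (2 * k))"
      by (intro sum_mono c(2)) auto
    also have "\<dots> = (\<Sum>j\<in>(\<lambda>k. 2 * k) ` {1..?m}. ?g j)"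
      by (subst sum.reindex) (auto simp: inj_on_def)
    also have "\<dots> \<le> (\<Sum>j\<le>n. ?g j)"
      by (intro sum_mono2 path_prob_nonneg) auto
    finally show ?thesis by simp
  qed
  then show ?thesis using c(1) by (intro exI[of _ "c / 2"]) auto
qed

section \<open>The random walk and its escape probability\<close>

text \<open>The steps with index \<open>1, ..., n\<close>, as a sequence.\<close>

definition steps :: "(nat \<Rightarrow> 'a \<Rightarrow> int ^ 'd) \<Rightarrow> nat \<Rightarrow> 'a \<Rightarrow> (int ^ 'd) list"
  where "steps X n \<omega> = map (\<lambda>k. X k \<omega>) [1..<Suc n]"

lemma length_steps [simp]: "length (steps X n \<omega>) = n"
  by (simp add: steps_def)

lemma nth_steps: "k < n \<Longrightarrow> steps X n \<omega> ! k = X (Suc k) \<omega>"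
  by (simp add: steps_def nth_map_upt del: upt_Suc)

lemma take_steps: "j \<le> n \<Longrightarrow> take j (steps X n \<omega>) = steps X j \<omega>"
  by (simp add: list_eq_iff_nth_eq nth_steps)

lemma sum_list_steps: "sum_list (steps X n \<omega>) = walk X n \<omega>"
  by (simp add: steps_def walk_def interv_sum_list_conv_sum_set_nat atLeastLessThanSuc_atLeastAtMost
      del: upt_Suc)

lemma visits_steps: "visits (steps X n \<omega>) x = local_time X x n \<omega>"
proof -
  have "{j \<in> {1..n}. sum_list (take j (steps X n \<omega>)) = x} =
      {k. 0 < k \<and> k \<le> n \<and> walk X k \<omega> = x}"
    by (auto simp: take_steps sum_list_steps)
  then show ?thesis by (simp add: visits_def local_time_def)
qed

context simple_symmetric_random_walk
begin

lemma steps_eq_sets [measurable]: "{\<omega> \<in> space M. steps X n \<omega> = xs} \<in> events"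
proof (cases "length xs = n")
  case True
  have "{\<omega> \<in> space M. steps X n \<omega> = xs} = {\<omega> \<in> space M. \<forall>k\<in>{..<n}. X (Suc k) \<omega> = xs ! k}"
    using True by (auto simp: list_eq_iff_nth_eq nth_steps)
  also have "\<dots> \<in> events"
  proof (intro sets.sets_Collect_finite_All)
    fix k assume "k \<in> {..<n}"
    have "X (Suc k) \<in> measurable M (count_space UNIV)"
      using indep_steps unfolding indep_vars_def by auto
    then have "X (Suc k) -` {xs ! k} \<inter> space M \<in> events"
      by (rule measurable_sets) simp
    also have "X (Suc k) -` {xs ! k} \<inter> space M = {\<omega> \<in> space M. X (Suc k) \<omega> = xs ! k}" by auto
    finally show "{\<omega> \<in> space M. X (Suc k) \<omega> = xs ! k} \<in> events" .
  qed simp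
  finally show ?thesis .
next
  case False
  then have e: "{\<omega> \<in> space M. steps X n \<omega> = xs} = {}" by auto
  show ?thesis unfolding e by simp
qed

lemma steps_sets [measurable]: "{\<omega> \<in> space M. P (steps X n \<omega>)} \<in> events"
proof -
  have "{\<omega> \<in> space M. P (steps X n \<omega>)} = (\<Union>xs\<in>{xs. P xs}. {\<omega> \<in> space M. steps X n \<omega> = xs})"
    by auto
  also have "\<dots> \<in> events"
    by (intro sets.countable_UN'' steps_eq_sets) auto
  finally show ?thesis .
qed

lemma prob_steps_eq:
  assumes "set xs \<subseteq> unit_steps" "length xs = n"
  shows "prob {\<omega> \<in> space M. steps X n \<omega> = xs} = 1 / (2 * real CARD('d)) ^ n"
proof (cases "n = 0")
  case True
  with assms have "{\<omega> \<in> space M. steps X n \<omega> = xs} = space M" by (auto simp: steps_def)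
  with True show ?thesis by (simp add: prob_space)
next
  case False
  let ?A = "\<lambda>k. {xs ! (k - 1)}"
  have "{\<omega> \<in> space M. steps X n \<omega> = xs} = (\<Inter>k\<in>{1..n}. X k -` ?A k \<inter> space M)"
  proof (intro equalityI subsetI)
    fix \<omega> assume "\<omega> \<in> {\<omega> \<in> space M. steps X n \<omega> = xs}"
    then show "\<omega> \<in> (\<Inter>k\<in>{1..n}. X k -` ?A k \<inter> space M)"
      using nth_steps[of "k - 1" n X \<omega> for k] by auto
  next
    fix \<omega> assume \<omega>: "\<omega> \<in> (\<Inter>k\<in>{1..n}. X k -` ?A k \<inter> space M)"
    then have "X (Suc k) \<omega> = xs ! k" if "k < n" for k
      using that by (auto dest!: bspec[of _ _ "Suc k"])
    moreover have "\<omega> \<in> space M" using \<omega> False by auto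
    ultimately show "\<omega> \<in> {\<omega> \<in> space M. steps X n \<omega> = xs}"
      using assms by (simp add: list_eq_iff_nth_eq nth_steps)
  qed
  also have "prob \<dots> = (\<Prod>k\<in>{1..n}. prob (X k -` ?A k \<inter> space M))"
    using False by (intro indep_varsD[OF indep_steps]) auto
  also have "\<dots> = (\<Prod>k\<in>{1..n}. 1 / (2 * real CARD('d)))"
  proof (rule prod.cong[OF refl])
    fix k assume k: "k \<in> {1..n}"
    have eq: "X k -` ?A k \<inter> space M = {\<omega> \<in> space M. X k \<omega> = xs ! (k - 1)}" by auto
    have "xs ! (k - 1) \<in> unit_steps" using k assms by (auto simp: subset_iff)
    then show "prob (X k -` ?A k \<inter> space M) = 1 / (2 * real CARD('d))"
      unfolding eq unit_steps_def using k step_pos[of k] step_neg[of k] by auto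
  qed
  finally show ?thesis by (simp add: power_one_over)
qed

text \<open>Every event about the first \<open>n\<close> steps has the probability given by the uniform average, because the
  steps are almost surely unit steps.\<close>

lemma prob_steps: "prob {\<omega> \<in> space M. P (steps X n \<omega>)} = path_prob n P"
proof -
  let ?L = "{xs :: (int ^ 'd) list. set xs \<subseteq> unit_steps \<and> length xs = n}"
  have fin: "finite ?L" by (rule finite_lists_length_eq) simp
  have on_paths: "prob {\<omega> \<in> space M. Q (steps X n \<omega>) \<and> steps X n \<omega> \<in> ?L} = path_prob n Q" for Q
  proof -
    have "{\<omega> \<in> space M. Q (steps X n \<omega>) \<and> steps X n \<omega> \<in> ?L} =
        (\<Union>xs\<in>?L \<inter> {xs. Q xs}. {\<omega> \<in> space M. steps X n \<omega> = xs})" by auto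
    then have "prob {\<omega> \<in> space M. Q (steps X n \<omega>) \<and> steps X n \<omega> \<in> ?L} =
        (\<Sum>xs\<in>?L \<inter> {xs. Q xs}. prob {\<omega> \<in> space M. steps X n \<omega> = xs})"
      using fin by (simp only:) (intro finite_measure_finite_Union,
          auto simp: disjoint_family_on_def intro: steps_eq_sets)
    also have "\<dots> = (\<Sum>xs\<in>?L \<inter> {xs. Q xs}. 1 / (2 * real CARD('d)) ^ n)"
      by (intro sum.cong prob_steps_eq) auto
    also have "\<dots> = (\<Sum>xs\<in>?L. of_bool (Q xs)) / (2 * real CARD('d)) ^ n"
      using fin by (simp only: sum_of_bool_eq) simp
    finally show ?thesis unfolding path_mean_eq_sum .
  qed
  have "prob {\<omega> \<in> space M. steps X n \<omega> \<in> ?L} = 1"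
    using on_paths[of "\<lambda>_. True"] by simp
  then have "AE \<omega> in M. steps X n \<omega> \<in> ?L"
    by (rule AE_prob_1[THEN AE_mp]) simp
  then have "prob {\<omega> \<in> space M. P (steps X n \<omega>)} =
      prob {\<omega> \<in> space M. P (steps X n \<omega>) \<and> steps X n \<omega> \<in> ?L}"
    by (intro finite_measure_eq_AE) (auto intro: steps_sets
      steps_sets[of "\<lambda>xs. P xs \<and> set xs \<subseteq> unit_steps \<and> length xs = n" n, simplified])
  with on_paths show ?thesis by simp
qed

lemma return_prob_tendsto: "(\<lambda>n. return_prob TYPE('d) n) \<longlonglongrightarrow> 1 - escape_prob M X"
proof -
  let ?A = "\<lambda>n. {\<omega> \<in> space M. \<not> (\<exists>i\<in>{0<..n}. sum_list (take i (steps X n \<omega>)) \<in> {0})}"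
  have A: "?A n = {\<omega> \<in> space M. \<forall>i\<in>{0<..n}. walk X i \<omega> \<noteq> 0}" for n
    by (auto simp: take_steps sum_list_steps)
  have "(\<lambda>n. prob (?A n)) \<longlonglongrightarrow> prob (\<Inter>n. ?A n)"
  proof (rule finite_Lim_measure_decseq)
    show "range ?A \<subseteq> events"
    proof (rule image_subsetI)
      fix n show "?A n \<in> events"
        by (rule steps_sets[of "\<lambda>xs. \<not> (\<exists>i\<in>{0<..n}. sum_list (take i xs) \<in> {0})" n])
    qed
    show "decseq ?A" unfolding A decseq_def by auto
  qed
  also have "(\<Inter>n. ?A n) = {\<omega> \<in> space M. \<forall>k\<ge>1. walk X k \<omega> \<noteq> 0}"
    unfolding A by (auto simp: Suc_le_eq) (metis greaterThanAtMost_iff order_refl)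
  finally have "(\<lambda>n. 1 - prob (?A n)) \<longlonglongrightarrow> 1 - escape_prob M X"
    unfolding escape_prob_def by (intro tendsto_diff tendsto_const)
  moreover have "prob (?A n) = 1 - return_prob TYPE('d) n" for n
    using prob_steps[of "\<lambda>xs. \<not> (\<exists>i\<in>{0<..n}. sum_list (take i xs) \<in> {0})" n]
    unfolding path_prob_not by simp
  ultimately show ?thesis by simp
qed

end

lemma return_prob_mono: "m \<le> n \<Longrightarrow> return_prob TYPE('d::finite) m \<le> return_prob TYPE('d) n"
proof -
  assume "m \<le> n"
  have "return_prob TYPE('d) m = (\<Sum>j\<in>{0<..m}. path_prob j (first_hit 0 {0 :: int ^ 'd}))"
    by (rule hit_prob_eq_sum)
  also have "\<dots> \<le> (\<Sum>j\<in>{0<..n}. path_prob j (first_hit 0 {0 :: int ^ 'd}))"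
    using \<open>m \<le> n\<close> by (intro sum_mono2 path_prob_nonneg) auto
  finally show ?thesis unfolding hit_prob_eq_sum .
qed

lemma (in simple_symmetric_random_walk) return_prob_le: "return_prob TYPE('d) n \<le> 1 - escape_prob M X"
  by (rule incseq_le[OF monoI return_prob_tendsto]) (rule return_prob_mono)

lemma return_prob_two_pos: "return_prob TYPE('d::finite) 2 > 0"
proof -
  have ex: "\<exists>i\<in>{0<..2}. sum_list (take i xs) \<in> {0}" if "sum_list xs = 0" "length xs = 2"
    for xs :: "(int ^ 'd) list"
    using that by (intro bexI[of _ 2]) auto
  have "(1 :: real) = (\<Sum>v\<in>(unit_steps :: (int ^ 'd) set). 1) / (2 * real CARD('d))"
    by (simp add: card_unit_steps)
  also have "\<dots> \<le> (\<Sum>v\<in>unit_steps. \<Sum>w\<in>unit_steps. of_bool (sum_list [v, w :: int ^ 'd] = 0)) / (2 * real CARD('d))"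
  proof (intro divide_right_mono sum_mono)
    fix v :: "int ^ 'd" assume "v \<in> unit_steps"
    then have "- v \<in> unit_steps" using uminus_unit_steps by blast
    then have "(\<Sum>w\<in>{- v}. of_bool (sum_list [v, w] = 0)) \<le>
        (\<Sum>w\<in>unit_steps. of_bool (sum_list [v, w] = 0) :: real)"
      by (intro sum_mono2) auto
    then show "1 \<le> (\<Sum>w\<in>unit_steps. of_bool (sum_list [v, w] = 0) :: real)" by simp
  qed simp
  also have "\<dots> = 2 * real CARD('d) * path_prob 2 (\<lambda>xs. sum_list xs = (0 :: int ^ 'd))"
    by (simp add: numeral_2_eq_2 sum_divide_distrib[symmetric] del: sum_of_bool_eq)
  also have "\<dots> \<le> 2 * real CARD('d) * return_prob TYPE('d) 2"
    by (intro mult_left_mono path_prob_mono ex) auto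
  finally have "0 < 2 * real CARD('d) * return_prob TYPE('d) 2" by linarith
  then show ?thesis by (simp add: zero_less_mult_iff)
qed

lemma mean_visits_zero:
  "path_mean n (\<lambda>xs :: (int ^ 'd) list. real (visits xs 0)) =
    (\<Sum>j\<in>{1..n}. path_prob j (\<lambda>xs. sum_list xs \<in> {0 :: int ^ 'd}))"
proof -
  have eq: "real (visits xs 0) = (\<Sum>j\<in>{1..n}. of_bool (sum_list (take j xs) \<in> {0}))"
    if "length xs = n" for xs :: "(int ^ 'd) list"
    using that by (simp add: visits_def Int_def)
  have "path_mean n (\<lambda>xs :: (int ^ 'd) list. real (visits xs 0)) =
      path_mean n (\<lambda>xs :: (int ^ 'd) list. \<Sum>j\<in>{1..n}. of_bool (sum_list (take j xs) \<in> {0}))"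
    by (rule path_mean_cong, rule eq)
  also have "\<dots> = (\<Sum>j\<in>{1..n}. path_prob n (\<lambda>xs. sum_list (take j xs) \<in> {0 :: int ^ 'd}))"
    unfolding path_mean_sum ..
  also have "\<dots> = (\<Sum>j\<in>{1..n}. path_prob j (\<lambda>xs. sum_list xs \<in> {0 :: int ^ 'd}))"
    by (intro sum.cong refl path_mean_take[where f = "\<lambda>xs. of_bool (sum_list xs \<in> {0})"]) auto
  finally show ?thesis .
qed

text \<open>A return within \<open>s\<close> steps that has probability \<open>\<rho>\<close> leads to \<open>m\<close> visits by time \<open>m * s\<close> with
  probability at least \<open>\<rho> ^ m\<close>, while the expected number of visits to the origin is bounded.\<close>

lemma return_prob_power_bound:
  assumes "CARD('d) \<ge> 3"
  shows "\<exists>m. \<forall>s. return_prob TYPE('d::finite) s ^ m \<le> 1 / 2"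
proof -
  obtain K where K: "\<And>n. (\<Sum>j<n. path_prob j (\<lambda>xs. sum_list xs \<in> {0 :: int ^ 'd})) \<le> K"
    using origin_green_bounded[OF assms] by blast
  obtain m :: nat where m: "2 * \<bar>K\<bar> + 1 < real m" using reals_Archimedean2 by blast
  have "return_prob TYPE('d) s ^ m \<le> 1 / 2" for s
  proof -
    have "real m * return_prob TYPE('d) s ^ m \<le>
        real m * path_prob (m * s) (\<lambda>xs :: (int ^ 'd) list. visits xs 0 \<ge> m)"
      by (intro mult_left_mono path_prob_visits_ge) simp
    also have "\<dots> \<le> path_mean (m * s) (\<lambda>xs :: (int ^ 'd) list. real (visits xs 0))"
      unfolding path_mean_cmult[symmetric] by (rule path_mean_mono) (simp add: of_bool_def)
    also have "\<dots> \<le> (\<Sum>j<Suc (m * s). path_prob j (\<lambda>xs. sum_list xs \<in> {0 :: int ^ 'd}))"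
      unfolding mean_visits_zero by (intro sum_mono2 path_prob_nonneg) auto
    also have "\<dots> \<le> K" by (rule K)
    also have "\<dots> \<le> real m * (1 / 2)" using m by linarith
    finally show ?thesis by (rule mult_left_le_imp_le) (use m in linarith)
  qed
  then show ?thesis by blast
qed

lemma (in simple_symmetric_random_walk) escape_prob_strictly_between:
  assumes "CARD('d) \<ge> 3"
  shows "0 < escape_prob M X" "escape_prob M X < 1"
proof -
  obtain m where m: "\<And>s. return_prob TYPE('d) s ^ m \<le> 1 / 2"
    using return_prob_power_bound[OF assms] by blast
  have "(1 - escape_prob M X) ^ m \<le> 1 / 2"
    by (rule LIMSEQ_le_const2[OF tendsto_power[OF return_prob_tendsto]]) (use m in auto)
  then have "escape_prob M X \<noteq> 0" by auto
  then show "0 < escape_prob M X"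
    unfolding escape_prob_def by (simp add: zero_less_measure_iff)
  show "escape_prob M X < 1"
    using return_prob_le[of 2] return_prob_two_pos[where 'd = 'd] by linarith
qed

section \<open>Interpolation along a doubly exponential time scale\<close>

lemma local_time_mono: "m \<le> n \<Longrightarrow> local_time X x m \<omega> \<le> local_time X x n \<omega>"
  unfolding local_time_def by (intro card_mono) auto

lemma local_time_le: "local_time X x n \<omega> \<le> n"
proof -
  have "local_time X x n \<omega> \<le> card {1..n}"
    unfolding local_time_def by (intro card_mono) auto
  then show ?thesis by simp
qed

lemma max_local_time_ge_iff:
  assumes "A \<noteq> {}"
  shows "k \<le> max_local_time X A n \<omega> \<longleftrightarrow> (\<exists>x\<in>A. k \<le> local_time X x n \<omega>)"
proof -
  have "finite ((\<lambda>x. local_time X x n \<omega>) ` A)"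
    by (rule finite_subset[of _ "{..n}"]) (auto simp: local_time_le)
  then show ?thesis unfolding max_local_time_def using assms by (subst Max_ge_iff) auto
qed

lemma max_local_time_mono:
  assumes "A \<noteq> {}" "m \<le> n"
  shows "max_local_time X A m \<omega> \<le> max_local_time X A n \<omega>"
proof -
  obtain x where "x \<in> A" "max_local_time X A m \<omega> \<le> local_time X x m \<omega>"
    using max_local_time_ge_iff[OF assms(1), of "max_local_time X A m \<omega>" X m \<omega>] by auto
  moreover have "local_time X x m \<omega> \<le> local_time X x n \<omega>"
    by (rule local_time_mono[OF assms(2)])
  ultimately show ?thesis
    unfolding max_local_time_ge_iff[OF assms(1)] by (intro bexI[of _ x]) auto
qed

lemma two_times_le_two_power: "2 * i \<le> (2::nat) ^ i"
proof (induction i)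
  case (Suc i)
  show ?case
  proof (cases "i = 0")
    case False
    then have "(2::nat) ^ 1 \<le> 2 ^ i" by (intro power_increasing) auto
    with Suc show ?thesis by simp
  qed simp
qed simp

text \<open>Along these times \<open>ln (ln _)\<close> is affine in \<open>i\<close>, so probabilities that are small powers of
  \<open>ln n\<close> decay geometrically in \<open>i\<close>; yet consecutive values of \<open>ln (ln _)\<close> have ratios tending to 1,
  and passing from one time to the next is squaring.\<close>

definition time_scale :: "nat \<Rightarrow> nat"
  where "time_scale i = 2 ^ (2 ^ i)"

lemma time_scale_Suc: "time_scale (Suc i) = time_scale i * time_scale i"
  by (simp only: time_scale_def power_Suc mult_2 power_add)

lemma ln_time_scale: "ln (real (time_scale i)) = 2 ^ i * ln 2"
  by (simp add: time_scale_def ln_realpow)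

lemma time_scale_ge: "4 ^ i \<le> time_scale i" "2 \<le> time_scale i"
proof -
  have "(4::nat) ^ i = 2 ^ (2 * i)" by (simp add: power_mult)
  also have "\<dots> \<le> time_scale i"
    unfolding time_scale_def by (intro power_increasing two_times_le_two_power) auto
  finally show "4 ^ i \<le> time_scale i" .
  have "(2::nat) ^ 1 \<le> 2 ^ 2 ^ i" by (intro power_increasing) auto
  then show "2 \<le> time_scale i" by (simp add: time_scale_def)
qed

text \<open>A time \<open>n\<close> lies between two consecutive times of the scale, at which \<open>ln (ln _)\<close> differs from
  \<open>ln (ln n)\<close> by at most \<open>ln 2\<close>.\<close>

lemma limit_from_time_scale:
  fixes m :: "nat \<Rightarrow> nat" and l :: real
  assumes mono: "\<And>i j. i \<le> j \<Longrightarrow> m i \<le> m j" and l: "l > 0"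
    and upper: "\<And>j. eventually (\<lambda>i. real (m (time_scale i)) \<le>
      (1 + 1 / (real j + 2)) * l * (real i * ln 2) + 1) sequentially"
    and lower: "\<And>j. eventually (\<lambda>i. (1 - 1 / (real j + 2)) * l * (real i * ln 2) - 1 \<le>
      real (m (time_scale (Suc i)))) sequentially"
  shows "(\<lambda>n. real (m n) / ln (ln (real n))) \<longlonglongrightarrow> l"
proof (rule tendstoI)
  fix e :: real assume e: "e > 0"
  define L where "L n = ln (ln (real n))" for n
  \<comment> \<open>the real solution of \<open>n = 2 powr (2 powr y)\<close>, so \<open>n\<close> lies
    between \<open>time_scale (\<iota> n)\<close> and its successor\<close>
  define y where "y n = (L n - ln (ln 2)) / ln 2" for n
  define \<iota> where "\<iota> n = nat \<lfloor>y n\<rfloor>" for n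
  have ln2: "0 < ln (2::real)" by simp
  \<comment> \<open>large enough that the factors \<open>1 \<plusminus> \<epsilon>\<close> change
    \<open>l\<close> by less than \<open>e / 2\<close>\<close>
  obtain j :: nat where j: "2 * l / e < real j" using reals_Archimedean2 by blast
  define \<epsilon> where "\<epsilon> = 1 / (real j + 2)"
  have \<epsilon>: "0 < \<epsilon>" "\<epsilon> < 1" by (auto simp: \<epsilon>_def divide_simps)
  have \<epsilon>l: "\<epsilon> * l < e / 2"
  proof -
    have "2 * l < e * real j" using j e by (simp add: field_simps)
    also have "\<dots> < e * (real j + 2)" using e by simp
    finally show ?thesis by (simp add: \<epsilon>_def field_simps)
  qed
  have y_top: "filterlim y at_top sequentially"
    unfolding y_def L_def by real_asymp
  have L_pos: "eventually (\<lambda>n. L n > 0) sequentially"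
    unfolding L_def by real_asymp
  have \<iota>_top: "filterlim \<iota> at_top sequentially"
    unfolding \<iota>_def by (intro filterlim_compose[OF filterlim_nat_sequentially]
      filterlim_compose[OF filterlim_floor_sequentially] y_top)
  have \<iota>1_top: "filterlim (\<lambda>n. \<iota> n - 1) at_top sequentially"
    by (rule filterlim_compose[OF filterlim_minus_const_nat_at_top \<iota>_top])
  have up: "eventually (\<lambda>n. real (m (time_scale (Suc (\<iota> n)))) \<le>
      (1 + \<epsilon>) * l * (real (Suc (\<iota> n)) * ln 2) + 1) sequentially"
    using eventually_compose_filterlim[OF upper[of j] filterlim_compose[OF filterlim_Suc \<iota>_top]]
    unfolding \<epsilon>_def by simp
  have lo: "eventually (\<lambda>n. (1 - \<epsilon>) * l * (real (\<iota> n - 1) * ln 2) - 1 \<le>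
      real (m (time_scale (Suc (\<iota> n - 1))))) sequentially"
    using eventually_compose_filterlim[OF lower[of j] \<iota>1_top] unfolding \<epsilon>_def by simp
  have lim_up: "(\<lambda>n. ((1 + \<epsilon>) * l * (L n - ln (ln 2) + ln 2) + 1) / L n) \<longlonglongrightarrow> (1 + \<epsilon>) * l"
    unfolding L_def by real_asymp
  have lim_lo: "(\<lambda>n. ((1 - \<epsilon>) * l * (L n - ln (ln 2) - 2 * ln 2) - 1) / L n) \<longlonglongrightarrow> (1 - \<epsilon>) * l"
    unfolding L_def by real_asymp
  have ev_up: "eventually (\<lambda>n. ((1 + \<epsilon>) * l * (L n - ln (ln 2) + ln 2) + 1) / L n < l + e) sequentially"
    using \<epsilon>l e by (intro order_tendstoD(2)[OF lim_up]) (simp add: algebra_simps)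
  have ev_lo: "eventually (\<lambda>n. l - e < ((1 - \<epsilon>) * l * (L n - ln (ln 2) - 2 * ln 2) - 1) / L n) sequentially"
    using \<epsilon>l e by (intro order_tendstoD(1)[OF lim_lo]) (simp add: algebra_simps)
  have "eventually (\<lambda>n. y n \<ge> 1) sequentially"
    using y_top by (auto simp: filterlim_at_top)
  with up lo ev_up ev_lo L_pos eventually_ge_at_top[of 2]
  show "eventually (\<lambda>n. dist (real (m n) / ln (ln (real n))) l < e) sequentially"
  proof eventually_elim
    case (elim n)
    have fl: "real (\<iota> n) \<le> y n" "y n \<le> real (\<iota> n) + 1" "\<iota> n \<ge> 1"
    proof -
      have "0 \<le> \<lfloor>y n\<rfloor>" using elim by simp
      then have "real (\<iota> n) = of_int \<lfloor>y n\<rfloor>" by (simp add: \<iota>_def)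
      then show "real (\<iota> n) \<le> y n" "y n \<le> real (\<iota> n) + 1" by linarith+
      show "\<iota> n \<ge> 1" using elim by (simp add: \<iota>_def le_nat_iff)
    qed
    have n: "real n \<ge> 2" "ln (real n) > 0" using elim by simp_all
    have yL: "y n * ln 2 = L n - ln (ln 2)" by (simp add: y_def)
    have scale: "ln (ln (real (time_scale i))) = real i * ln 2 + ln (ln 2)" for i
      unfolding ln_time_scale by (simp add: ln_mult_pos ln_realpow)
    have lnpos: "ln (real (time_scale i)) > 0" "real (time_scale i) > 0" for i
      unfolding ln_time_scale by (simp_all add: time_scale_def)
    have "real (\<iota> n) * ln 2 \<le> y n * ln 2" "y n * ln 2 \<le> real (Suc (\<iota> n)) * ln 2"
      using fl by (intro mult_right_mono; simp)+
    then have "ln (ln (real (time_scale (\<iota> n)))) \<le> L n" "L n \<le> ln (ln (real (time_scale (Suc (\<iota> n)))))"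
      unfolding scale using yL by linarith+
    then have "time_scale (\<iota> n) \<le> n" "n \<le> time_scale (Suc (\<iota> n))"
      unfolding L_def using n lnpos by simp_all
    then have mm: "m (time_scale (\<iota> n)) \<le> m n" "m n \<le> m (time_scale (Suc (\<iota> n)))"
      by (auto intro: mono)
    have "real (m n) \<le> (1 + \<epsilon>) * l * (real (Suc (\<iota> n)) * ln 2) + 1"
      using mm(2) elim(1) by linarith
    also have "\<dots> \<le> (1 + \<epsilon>) * l * (L n - ln (ln 2) + ln 2) + 1"
    proof (intro add_right_mono mult_left_mono)
      have "real (Suc (\<iota> n)) * ln 2 = real (\<iota> n) * ln 2 + ln 2" by (simp add: distrib_right)
      also have "\<dots> \<le> y n * ln 2 + ln 2" using fl by (intro add_right_mono mult_right_mono) auto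
      finally show "real (Suc (\<iota> n)) * ln 2 \<le> L n - ln (ln 2) + ln 2" using yL by simp
      show "0 \<le> (1 + \<epsilon>) * l" using \<epsilon> l by simp
    qed
    finally have "real (m n) / L n \<le> ((1 + \<epsilon>) * l * (L n - ln (ln 2) + ln 2) + 1) / L n"
      using elim by (intro divide_right_mono) auto
    with elim have 1: "real (m n) / L n < l + e" by linarith
    have "(1 - \<epsilon>) * l * (L n - ln (ln 2) - 2 * ln 2) - 1 \<le> (1 - \<epsilon>) * l * (real (\<iota> n - 1) * ln 2) - 1"
    proof (intro diff_right_mono mult_left_mono)
      have "y n - 2 \<le> real (\<iota> n - 1)" using fl by simp
      then have "(y n - 2) * ln 2 \<le> real (\<iota> n - 1) * ln 2" by (intro mult_right_mono) auto
      then show "L n - ln (ln 2) - 2 * ln 2 \<le> real (\<iota> n - 1) * ln 2" using yL by (simp add: algebra_simps)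
      show "0 \<le> (1 - \<epsilon>) * l" using \<epsilon> l by simp
    qed
    also have "\<dots> \<le> real (m (time_scale (\<iota> n)))" using elim(2) fl by simp
    also have "\<dots> \<le> real (m n)" using mm by simp
    finally have "((1 - \<epsilon>) * l * (L n - ln (ln 2) - 2 * ln 2) - 1) / L n \<le> real (m n) / L n"
      using elim by (intro divide_right_mono) auto
    with elim have 2: "l - e < real (m n) / L n" by linarith
    show ?case using 1 2 unfolding L_def by (simp add: dist_real_def abs_less_iff)
  qed
qed

section \<open>The almost sure limit\<close>

lemma lattice_subspace_add_iff:
  "x \<in> lattice_subspace a b \<Longrightarrow> x + y \<in> lattice_subspace a b \<longleftrightarrow> y \<in> lattice_subspace a b"
  unfolding lattice_subspace_iff by (simp add: int_dot_add)

lemma zero_in_lattice_subspace: "0 \<in> lattice_subspace a b"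
  by (simp add: lattice_subspace_iff)

lemma real_time_scale_ge: "(4::real) ^ i \<le> real (time_scale i)"
  using time_scale_ge(1)[of i] by (metis of_nat_le_iff of_nat_numeral of_nat_power)

context simple_symmetric_random_walk
begin

lemma max_local_time_event:
  assumes "A \<noteq> {}"
  shows "{\<omega> \<in> space M. k \<le> max_local_time X A n \<omega>} =
    {\<omega> \<in> space M. \<exists>x\<in>A. k \<le> visits (steps X n \<omega>) x}"
  unfolding max_local_time_ge_iff[OF assms] visits_steps ..

text \<open>At time \<open>n = time_scale i\<close> the expected number of visits to the subspace is of order \<open>2 ^ i\<close>, and
  \<open>\<beta> ^ k\<close> with \<open>k = (1 + \<epsilon>) * \<lambda> * i * ln 2\<close> is \<open>2 powr (- (1 + \<epsilon>) * i)\<close>. The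
  product decays geometrically.\<close>

lemma max_local_time_upper_eventually:
  fixes a b :: "int ^ 'd"
  assumes d: "CARD('d) \<ge> 3" and ab: "a \<noteq> 0" "\<not> parallel_vec a b" and \<epsilon>: "\<epsilon> > 0"
  defines "l \<equiv> walk_lambda M X"
  shows "AE \<omega> in M. eventually (\<lambda>i.
    real (max_local_time X (lattice_subspace a b) (time_scale i) \<omega>) \<le>
      (1 + \<epsilon>) * l * (real i * ln 2) + 1) sequentially"
proof -
  let ?A = "lattice_subspace a b"
  have A: "?A \<noteq> {}" using zero_in_lattice_subspace by blast
  define \<beta> where "\<beta> = 1 - escape_prob M X"
  have \<beta>: "0 < \<beta>" "\<beta> < 1" using escape_prob_strictly_between[OF d] by (auto simp: \<beta>_def)
  have l: "l * ln \<beta> = - 1" "l > 0" using \<beta> by (auto simp: l_def walk_lambda_def \<beta>_def)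
  obtain K where K: "K > 0" "\<And>n. n \<ge> 2 \<Longrightarrow>
    (\<Sum>j\<le>n. path_prob j (\<lambda>xs. sum_list xs \<in> ?A)) \<le> K * ln (real n)"
    using lattice_subspace_green_le_log[OF ab] by blast
  define k where "k i = nat \<lceil>(1 + \<epsilon>) * l * (real i * ln 2)\<rceil>" for i
  have k_nonneg: "0 \<le> (1 + \<epsilon>) * l * (real i * ln 2)" for i using \<epsilon> l by simp
  have k: "(1 + \<epsilon>) * l * (real i * ln 2) \<le> real (k i)" "real (k i) \<le> (1 + \<epsilon>) * l * (real i * ln 2) + 1" for i
    using k_nonneg[of i] unfolding k_def by linarith+
  define U where "U i = {\<omega> \<in> space M. Suc (k i) \<le> max_local_time X ?A (time_scale i) \<omega>}" for i
  define q where "q = (1 / 2 :: real) powr \<epsilon>"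
  have q: "0 < q" "q < 1" unfolding q_def using \<epsilon> powr_less_mono'[of "1 / 2" 0 \<epsilon>] by auto
  have U_sets: "U i \<in> events" for i
    unfolding U_def max_local_time_event[OF A]
    by (rule steps_sets[of "\<lambda>xs. \<exists>x\<in>?A. Suc (k i) \<le> visits xs x"])
  have U_prob: "prob (U i) \<le> K * ln 2 * q ^ i" for i
  proof -
    have "prob (U i) = path_prob (time_scale i) (\<lambda>xs. \<exists>x\<in>?A. Suc (k i) \<le> visits xs x)"
      unfolding U_def max_local_time_event[OF A] by (rule prob_steps)
    also have "\<dots> \<le> (\<Sum>j\<in>{0<..time_scale i}. path_prob j (\<lambda>xs. sum_list xs \<in> ?A)) * \<beta> ^ k i"
      unfolding \<beta>_def by (rule path_prob_exists_visits_le[OF return_prob_le])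
    also have "\<dots> \<le> (\<Sum>j\<le>time_scale i. path_prob j (\<lambda>xs. sum_list xs \<in> ?A)) * \<beta> ^ k i"
      using \<beta> by (intro mult_right_mono sum_mono2 path_prob_nonneg) auto
    also have "\<dots> \<le> (K * (2 ^ i * ln 2)) * \<beta> ^ k i"
      using K(2)[OF time_scale_ge(2), of i] \<beta> unfolding ln_time_scale by (intro mult_right_mono) auto
    also have "\<beta> ^ k i \<le> (1 / 2) ^ i * q ^ i"
    proof -
      have "\<beta> ^ k i = exp (real (k i) * ln \<beta>)"
        using \<beta> by (simp add: powr_realpow[symmetric] powr_def)
      also have "real (k i) * ln \<beta> \<le> ((1 + \<epsilon>) * l * (real i * ln 2)) * ln \<beta>"
        using k(1)[of i] \<beta> by (intro mult_right_mono_neg) auto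
      also have "\<dots> = ((1 + \<epsilon>) * (real i * ln 2)) * (l * ln \<beta>)" by (simp only: mult_ac)
      also have "\<dots> = real i * ln (1 / 2) + real i * (\<epsilon> * ln (1 / 2))"
        unfolding l(1) by (simp add: ln_div algebra_simps)
      also have "exp \<dots> = (1 / 2) ^ i * q ^ i"
        unfolding q_def powr_def by (simp add: exp_add exp_of_nat_mult)
      finally show ?thesis by simp
    qed
    finally have "prob (U i) \<le> (K * (2 ^ i * ln 2)) * ((1 / 2) ^ i * q ^ i)" using K by simp
    also have "\<dots> = K * ln 2 * q ^ i * (2 ^ i * (1 / 2) ^ i)" by (simp only: mult_ac)
    also have "(2::real) ^ i * (1 / 2) ^ i = 1" by (simp flip: power_mult_distrib)
    finally show ?thesis by simp
  qed
  have "AE \<omega> in M. eventually (\<lambda>i. \<omega> \<in> space M - U i) sequentially"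
  proof (rule borel_cantelli_AE1)
    show "summable (\<lambda>i. prob (U i))"
    proof (rule summable_comparison_test)
      show "\<exists>N. \<forall>i\<ge>N. norm (prob (U i)) \<le> K * ln 2 * q ^ i" using U_prob by auto
      show "summable (\<lambda>i. K * ln 2 * q ^ i)"
        using q by (intro summable_mult summable_geometric) auto
    qed
  qed (auto simp: U_sets emeasure_eq_measure)
  then show ?thesis
  proof (rule AE_mp, intro AE_I2 impI)
    fix \<omega> assume "eventually (\<lambda>i. \<omega> \<in> space M - U i) sequentially"
    then show "eventually (\<lambda>i. real (max_local_time X ?A (time_scale i) \<omega>) \<le>
      (1 + \<epsilon>) * l * (real i * ln 2) + 1) sequentially"
    proof eventually_elim
      case (elim i)
      then have "max_local_time X ?A (time_scale i) \<omega> \<le> k i" unfolding U_def by auto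
      with k(2)[of i] show ?case by linarith
    qed
  qed
qed

text \<open>With \<open>N = time_scale i\<close> there is time for \<open>N\<close> attempts before \<open>N * N = time_scale (Suc i)\<close>. For
  \<open>k = (1 - \<epsilon>) * \<lambda> * i * ln 2\<close> an attempt succeeds with probability at least
  \<open>2 powr (- (1 - \<epsilon>\<^sup>2) * i)\<close>, whereas the wait for the next attempt exceeds \<open>N\<close> with probability of
  order \<open>i / 2 ^ i\<close>; the quotient of the latter by the former is summable.\<close>

lemma max_local_time_lower_eventually:
  fixes a b :: "int ^ 'd"
  assumes d: "CARD('d) \<ge> 3" and \<epsilon>: "0 < \<epsilon>" "\<epsilon> < 1"
  defines "l \<equiv> walk_lambda M X"
  shows "AE \<omega> in M. eventually (\<lambda>i. (1 - \<epsilon>) * l * (real i * ln 2) - 1 \<le>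
    real (max_local_time X (lattice_subspace a b) (time_scale (Suc i)) \<omega>)) sequentially"
proof -
  let ?A = "lattice_subspace a b"
  have A: "?A \<noteq> {}" using zero_in_lattice_subspace by blast
  define \<beta> where "\<beta> = 1 - escape_prob M X"
  have \<beta>: "0 < \<beta>" "\<beta> < 1" using escape_prob_strictly_between[OF d] by (auto simp: \<beta>_def)
  have l: "l * ln \<beta> = - 1" "l > 0" using \<beta> by (auto simp: l_def walk_lambda_def \<beta>_def)
  obtain c where c: "c > 0" "\<And>n. n \<ge> 4 \<Longrightarrow>
    c * ln (real n) \<le> (\<Sum>j\<le>n. path_prob j (\<lambda>xs. sum_list xs \<in> ?A))"
    using lattice_subspace_green_ge_log[of a b] by blast
  \<comment> \<open>slightly below \<open>\<beta>\<close>, hence exceeded by the probability of a return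
    within some finite time \<open>s\<close>\<close>
  define \<rho> where "\<rho> = \<beta> powr (1 + \<epsilon>)"
  have \<rho>: "0 < \<rho>" "\<rho> < \<beta>"
    using \<beta> \<epsilon> powr_less_mono'[of \<beta> 1 "1 + \<epsilon>"] by (auto simp: \<rho>_def)
  obtain s where s: "\<rho> < return_prob TYPE('d) s"
    using order_tendstoD(1)[OF return_prob_tendsto] \<rho>(2) unfolding \<beta>_def eventually_sequentially by blast
  define k where "k i = nat \<lfloor>(1 - \<epsilon>) * l * (real i * ln 2)\<rfloor>" for i
  have k_nonneg: "0 \<le> (1 - \<epsilon>) * l * (real i * ln 2)" for i using \<epsilon> l by simp
  have k: "real (k i) \<le> (1 - \<epsilon>) * l * (real i * ln 2)" "(1 - \<epsilon>) * l * (real i * ln 2) - 1 \<le> real (k i)" for i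
    using k_nonneg[of i] unfolding k_def by linarith+
  define w where "w i = k i * s" for i
  have w: "real (w i) \<le> l * real s * real i" for i
  proof -
    have "(1 - \<epsilon>) * l * (real i * ln 2) \<le> 1 * l * (real i * 1)"
      using \<epsilon> l ln_2_less_1 by (intro mult_mono) auto
    with k(1)[of i] have "real (k i) \<le> l * real i" by linarith
    then have "real (k i) * real s \<le> (l * real i) * real s" by (intro mult_right_mono) auto
    then show ?thesis by (simp add: w_def mult_ac)
  qed
  \<comment> \<open>\<open>\<theta> ^ i\<close> is a lower bound for \<open>\<rho> ^ k i\<close>, and thus for
    the probability that an attempt succeeds\<close>
  define \<theta> where "\<theta> = (1 / 2 :: real) powr (1 - \<epsilon>\<^sup>2)"
  have \<theta>: "0 < \<theta>" "1 / 2 \<le> \<theta>" "\<theta> \<le> 1"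
  proof -
    have e2: "0 \<le> \<epsilon>\<^sup>2" "\<epsilon>\<^sup>2 \<le> 1" using \<epsilon> by (auto intro: power_le_one)
    show "0 < \<theta>" by (simp add: \<theta>_def)
    have "(1 / 2 :: real) powr 1 \<le> \<theta>" unfolding \<theta>_def using e2 by (intro powr_mono') auto
    then show "1 / 2 \<le> \<theta>" by simp
    show "\<theta> \<le> 1" unfolding \<theta>_def using e2 by (intro powr_le1) auto
  qed
  \<comment> \<open>the geometric rate of decay of \<open>r / p\<close> in \<open>fail_prob_le\<close>, up to
    a factor linear in \<open>i\<close>\<close>
  define q where "q = (1 / 2) / \<theta>"
  have q: "0 < q" "q < 1"
  proof -
    show "0 < q" using \<theta> by (simp add: q_def)
    have "(1 / 2 :: real) powr 1 < \<theta>" unfolding \<theta>_def using \<epsilon> by (intro powr_less_mono') auto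
    then show "q < 1" using \<theta> by (simp add: q_def)
  qed
  have success: "\<theta> ^ i \<le> path_prob (w i) (\<lambda>xs :: (int ^ 'd) list. k i \<le> visits xs 0)" for i
  proof -
    have "\<theta> ^ i = exp (real i * ((1 - \<epsilon>\<^sup>2) * ln (1 / 2)))"
      by (simp add: \<theta>_def powr_def exp_of_nat_mult)
    also have "real i * ((1 - \<epsilon>\<^sup>2) * ln (1 / 2)) =
        ((1 - \<epsilon>) * (1 + \<epsilon>) * (real i * ln 2)) * (l * ln \<beta>)"
      unfolding l(1) by (simp add: ln_div power2_eq_square algebra_simps)
    also have "\<dots> = ((1 - \<epsilon>) * l * (real i * ln 2)) * ((1 + \<epsilon>) * ln \<beta>)" by (simp only: mult_ac)
    also have "\<dots> \<le> real (k i) * ((1 + \<epsilon>) * ln \<beta>)"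
      using k(1)[of i] \<epsilon> \<beta> by (intro mult_right_mono_neg) (auto simp: mult_nonneg_nonpos)
    finally have "\<theta> ^ i \<le> exp (real (k i) * ((1 + \<epsilon>) * ln \<beta>))" by simp
    also have "\<dots> = \<rho> ^ k i"
      using \<beta> by (simp add: \<rho>_def powr_def exp_of_nat_mult)
    also have "\<dots> \<le> return_prob TYPE('d) s ^ k i"
      using s \<rho> by (intro power_mono) auto
    also have "\<dots> \<le> path_prob (w i) (\<lambda>xs :: (int ^ 'd) list. k i \<le> visits xs 0)"
      unfolding w_def by (rule path_prob_visits_ge)
    finally show ?thesis .
  qed
  define F where "F i = {\<omega> \<in> space M. \<not> k i \<le> max_local_time X ?A (time_scale (Suc i)) \<omega>}" for i
  have F_eq: "F i = {\<omega> \<in> space M. \<not> (\<exists>x\<in>?A. k i \<le> visits (steps X (time_scale (Suc i)) \<omega>) x)}" for i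
    unfolding F_def max_local_time_ge_iff[OF A] visits_steps ..
  have F_sets: "F i \<in> events" for i
    unfolding F_eq by (rule steps_sets[of "\<lambda>xs. \<not> (\<exists>x\<in>?A. k i \<le> visits xs x)"])
  define C where "C = (l * real s + 1) / (c * ln 2)"
  have F_prob: "prob (F i) \<le> C * (real (Suc i) * q ^ i) + (1 / 2) ^ i"
    if i: "i \<ge> 1" and wi: "w i \<le> time_scale i" for i
  proof -
    let ?N = "time_scale i"
    define r where "r = path_prob ?N (\<lambda>xs. \<not> (\<exists>j\<in>{w i<..?N}. sum_list (take j xs) \<in> ?A))"
    have r0: "r \<ge> 0" unfolding r_def by (rule path_prob_nonneg)
    have "(4::nat) ^ 1 \<le> 4 ^ i" using i by (intro power_increasing) auto
    then have N4: "?N \<ge> 4" using order_trans[OF _ time_scale_ge(1)] by simp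
    have "c * (2 ^ i * ln 2) * r \<le> (\<Sum>j\<le>?N. path_prob j (\<lambda>xs. sum_list xs \<in> ?A)) * r"
      using c(2)[OF N4] r0 unfolding ln_time_scale by (intro mult_right_mono) auto
    also have "\<dots> \<le> real (w i + 1)"
      unfolding r_def by (rule hitting_mass_times_avoidance_le) (rule lattice_subspace_add_iff)
    also have "\<dots> \<le> (l * real s + 1) * real (Suc i)"
    proof -
      have "0 \<le> l * real s" using l by simp
      then show ?thesis using w[of i] by (simp add: algebra_simps)
    qed
    finally have "r * (c * (2 ^ i * ln 2)) \<le> (l * real s + 1) * real (Suc i)"
      by (simp only: mult.commute[of r])
    moreover have "0 < c * (2 ^ i * ln 2)" using c by simp
    ultimately have "r \<le> (l * real s + 1) * real (Suc i) / (c * (2 ^ i * ln 2))"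
      by (simp only: pos_le_divide_eq)
    also have "x * y / (c * (z * ln 2)) = x / (c * ln 2) * y * (1 / z)" for x y z :: real
      by (simp add: mult_ac)
    then have "(l * real s + 1) * real (Suc i) / (c * (2 ^ i * ln 2)) = C * real (Suc i) * (1 / 2) ^ i"
      unfolding C_def power_one_over .
    finally have "r / \<theta> ^ i \<le> C * real (Suc i) * (1 / 2) ^ i / \<theta> ^ i"
      using \<theta> by (intro divide_right_mono) auto
    also have "\<dots> = C * (real (Suc i) * q ^ i)"
      by (simp add: q_def power_divide)
    finally have r: "r / \<theta> ^ i \<le> C * (real (Suc i) * q ^ i)" .
    have "(1 - \<theta> ^ i) ^ ?N \<le> (1 / 2) ^ i"
    proof -
      have \<theta>i: "0 < \<theta> ^ i" "\<theta> ^ i \<le> 1" using \<theta> by (auto intro: power_le_one)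
      have "(1 - \<theta> ^ i) ^ ?N \<le> exp (- (\<theta> ^ i)) ^ ?N"
        using \<theta>i exp_ge_add_one_self[of "- (\<theta> ^ i)"] by (intro power_mono) auto
      also have "\<dots> = inverse (exp (real ?N * \<theta> ^ i))"
        by (simp add: exp_of_nat_mult exp_minus power_inverse)
      also have "\<dots> \<le> inverse (2 ^ i)"
      proof (rule le_imp_inverse_le)
        have "(2::real) ^ i = 4 ^ i * (1 / 2) ^ i" by (simp flip: power_mult_distrib)
        also have "\<dots> \<le> real ?N * \<theta> ^ i"
        proof (intro mult_mono power_mono)
          show "4 ^ i \<le> real ?N" by (rule real_time_scale_ge)
        qed (use \<theta> in auto)
        also have "\<dots> \<le> exp (real ?N * \<theta> ^ i)"
          using exp_ge_add_one_self[of "real ?N * \<theta> ^ i"] by linarith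
        finally show "2 ^ i \<le> exp (real ?N * \<theta> ^ i)" .
      qed simp
      also have "\<dots> = (1 / 2) ^ i" by (simp only: power_one_over inverse_eq_divide)
      finally show ?thesis .
    qed
    moreover have "prob (F i) = fail_prob ?A (k i) (?N * ?N)"
      unfolding F_eq fail_prob_def time_scale_Suc[symmetric] by (rule prob_steps)
    moreover have "fail_prob ?A (k i) (?N * ?N) \<le> r / \<theta> ^ i + (1 - \<theta> ^ i) ^ ?N"
      unfolding r_def
      using \<theta> by (intro fail_prob_le lattice_subspace_add_iff zero_in_lattice_subspace wi success) auto
    ultimately show ?thesis using r by linarith
  qed
  have "AE \<omega> in M. eventually (\<lambda>i. \<omega> \<in> space M - F i) sequentially"
  proof (rule borel_cantelli_AE1)
    show "summable (\<lambda>i. prob (F i))"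
    proof (rule summable_comparison_test_ev)
      have "eventually (\<lambda>i. l * real s * real i \<le> 4 ^ i) sequentially"
        by real_asymp
      then have "eventually (\<lambda>i. w i \<le> time_scale i) sequentially"
      proof eventually_elim
        case (elim i)
        then have "real (w i) \<le> real (time_scale i)"
          using w[of i] real_time_scale_ge[of i] by linarith
        then show ?case by simp
      qed
      then show "eventually (\<lambda>i. norm (prob (F i)) \<le> C * (real (Suc i) * q ^ i) + (1 / 2) ^ i) sequentially"
        using eventually_ge_at_top[of 1] by eventually_elim (use F_prob in simp)
      have "summable (\<lambda>i. real (Suc i) * q ^ i)"
        using geometric_deriv_sums[of q] q by (intro sums_summable[of _ "1 / (1 - q)\<^sup>2"]) simp
      then show "summable (\<lambda>i. C * (real (Suc i) * q ^ i) + (1 / 2) ^ i)"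
        by (intro summable_add summable_mult summable_geometric) simp_all
    qed
  qed (auto simp: F_sets emeasure_eq_measure)
  then show ?thesis
  proof (rule AE_mp, intro AE_I2 impI)
    fix \<omega> assume "eventually (\<lambda>i. \<omega> \<in> space M - F i) sequentially"
    then show "eventually (\<lambda>i. (1 - \<epsilon>) * l * (real i * ln 2) - 1 \<le>
      real (max_local_time X ?A (time_scale (Suc i)) \<omega>)) sequentially"
    proof eventually_elim
      case (elim i)
      then have "k i \<le> max_local_time X ?A (time_scale (Suc i)) \<omega>" unfolding F_def by auto
      with k(2)[of i] show ?case by linarith
    qed
  qed
qed

end

theorem theorem1p5:
  fixes M :: "'a measure"
    and X :: "nat \<Rightarrow> 'a \<Rightarrow> int ^ 'd"
    and a b :: "int ^ 'd"
  assumes "CARD('d) \<ge> 3"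
    and "simple_symmetric_random_walk M X"
    and "a \<noteq> 0" and "b \<noteq> 0" and "\<not> parallel_vec a b"
  shows "AE \<omega> in M.
    (\<lambda>n. real (max_local_time X (lattice_subspace a b) n \<omega>) / ln (ln (real n)))
      \<longlonglongrightarrow> walk_lambda M X"
proof -
  interpret simple_symmetric_random_walk M X by (rule assms(2))
  let ?m = "max_local_time X (lattice_subspace a b)" and ?l = "walk_lambda M X"
  have l: "?l > 0"
    using escape_prob_strictly_between[OF assms(1)] by (simp add: walk_lambda_def)
  have "AE \<omega> in M. \<forall>j. eventually (\<lambda>i. real (?m (time_scale i) \<omega>) \<le>
      (1 + 1 / (real j + 2)) * ?l * (real i * ln 2) + 1) sequentially"
    unfolding AE_all_countable using assms by (intro allI max_local_time_upper_eventually) auto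
  moreover have "AE \<omega> in M. \<forall>j. eventually (\<lambda>i. (1 - 1 / (real j + 2)) * ?l * (real i * ln 2) - 1 \<le>
      real (?m (time_scale (Suc i)) \<omega>)) sequentially"
    unfolding AE_all_countable using assms(1) by (intro allI max_local_time_lower_eventually) auto
  ultimately show ?thesis
  proof eventually_elim
    case (elim \<omega>)
    show ?case
    proof (rule limit_from_time_scale[OF _ l])
      show "?m i \<omega> \<le> ?m j \<omega>" if "i \<le> j" for i j
        using zero_in_lattice_subspace that by (intro max_local_time_mono) auto
    qed (use elim in blast)+
  qed
qed

end
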